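(* Let $n\ge 1$ and $1\le m\le n$ be integers, and let $0<R_1<R_2<\infty$. Model hyperbolic space $\mathbb{R}^{n+1}(-1)$ as $S^n\times[0,\infty)$ with metric $h=d\rho^2+\sinh^2\rho\, e$, where $e$ is the standard round metric on the unit sphere $S^n$, and let $\bar\Omega=\{(u,\rho): u\in S^n,\ \rho\in[R_1,R_2]\}$. Let $\psi(u,\rho)$ be a positive smooth function on $\bar\Omega$ satisfying $$\frac{\partial}{\partial\rho}\left[\psi(u,\rho)\sinh^m\rho\right]\le 0\quad\text{for all } u\in S^n,\ \rho\in[R_1,R_2].$$ Let $z_1,z_2\in C^2(S^n)$ be $m$-admissible functions with $R_1\le z_k(u)\le R_2$ for all $u\in S^n$, $k=1,2$, each solving $$H_m(\lambda(z_k(u)))=\psi(u,z_k(u))\quad\text{for all } u\in S^n.$$ Then there is a positive constant $c$ such that $$c\tanh\!\left(\tfrac{z_1(u)}{2}\right)=\tanh\!\left(\tfrac{z_2(u)}{2}\right)\quad\text{for all } u\in S^n.$$ If moreover the inequality $\frac{\partial}{\partial\rho}[\psi(u,\rho)\sinh^m\rho]<0$ holds strictly on $\bar\Omega$, then $c=1$, i.e. $z_1\equiv z_2$.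
   Context: For a positive function $z\in C^2(S^n)$, $M_z=\{(u,z(u)):u\in S^n\}$ is the radial graph of $z$. Its principal curvatures $\lambda(z(u))=(\lambda_1,\dots,\lambda_n)$ at $(u,z(u))$ are computed with respect to the inner normal (pointing toward decreasing $\rho$; with this convention geodesic spheres $\rho=\text{const}$ have positive principal curvatures). For $\lambda\in\mathbb{R}^n$, $S_m(\lambda)=\sum_{i_1<\dots<i_m}\lambda_{i_1}\cdots\lambda_{i_m}$ and $H_m(\lambda)=\binom{n}{m}^{-1}S_m(\lambda)$ is the $m$-th mean curvature. $\Gamma_m$ denotes the connected component of $\{\lambda\in\mathbb{R}^n: H_m(\lambda)>0\}$ containing the positive cone $\{\lambda:\lambda_1,\dots,\lambda_n>0\}$. A positive $z\in C^2(S^n)$ is $m$-admissible if $\lambda(z(u))\in\Gamma_m$ for every $u\in S^n$. *)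

theory Defs
  imports "HOL-Analysis.Analysis"
begin

definition dd :: "('a::real_normed_vector \<Rightarrow> real) \<Rightarrow> 'a \<Rightarrow> 'a \<Rightarrow> real" where
  "dd f v x = deriv (\<lambda>t. f (x + t *\<^sub>R v)) 0"

definition C2_on :: "'a::euclidean_space set \<Rightarrow> ('a \<Rightarrow> real) \<Rightarrow> bool" where
  "C2_on U f \<longleftrightarrow> open U \<and> f differentiable_on U \<and>
     (\<forall>i\<in>Basis. dd f i differentiable_on U) \<and>
     (\<forall>i\<in>Basis. \<forall>j\<in>Basis. continuous_on U (dd (dd f j) i))"

definition smooth_on :: "'a::euclidean_space set \<Rightarrow> ('a \<Rightarrow> real) \<Rightarrow> bool" where
  "smooth_on U f \<longleftrightarrow> open U \<and>
     (\<forall>vs. set vs \<subseteq> Basis \<longrightarrow> foldr (\<lambda>v g. dd g v) vs f differentiable_on U)"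

text \<open>The point (u,rho) of S^n x [0,inf) is represented by x = rho u in R^(n+1);
  the metric d rho^2 + sinh^2 rho e written in these Cartesian coordinates.\<close>
definition hyp_metric :: "'a::real_inner \<Rightarrow> 'a \<Rightarrow> 'a \<Rightarrow> real" where
  "hyp_metric x v w =
     (let u = x /\<^sub>R norm x; r = norm x
      in (u \<bullet> v) * (u \<bullet> w) + (sinh r / r)\<^sup>2 * (v \<bullet> w - (u \<bullet> v) * (u \<bullet> w)))"

definition hgrad :: "('a::real_inner \<Rightarrow> real) \<Rightarrow> 'a \<Rightarrow> 'a" where
  "hgrad F p = (THE W. \<forall>V. hyp_metric p W V = dd F V p)"

text \<open>Riemannian Hessian of F at p (Levi-Civita connection of h, via the Koszul
  formula for constant coordinate vector fields).\<close>
definition hhess :: "('a::real_inner \<Rightarrow> real) \<Rightarrow> 'a \<Rightarrow> 'a \<Rightarrow> 'a \<Rightarrow> real" where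
  "hhess F p X Y =
     (let W = hgrad F p;
          Dg = (\<lambda>A B C. dd (\<lambda>q. hyp_metric q B C) A p)
      in dd (\<lambda>q. dd F Y q) X p - (1/2) * (Dg X Y W + Dg Y X W - Dg W X Y))"

text \<open>The radial graph M_z = {(u, z u)} is the zero set of
  F(x) = |x| - z(x/|x|); F increases with rho, so the inner normal is
  -grad F / |grad F|, and the second fundamental form w.r.t. it is
  Hess F / |grad F|.\<close>
definition graph_fun :: "('a::real_normed_vector \<Rightarrow> real) \<Rightarrow> 'a \<Rightarrow> real" where
  "graph_fun z x = norm x - z (x /\<^sub>R norm x)"

definition sff :: "('a::real_inner \<Rightarrow> real) \<Rightarrow> 'a \<Rightarrow> 'a \<Rightarrow> 'a \<Rightarrow> real" where
  "sff z p X Y = hhess (graph_fun z) p X Y /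
       sqrt (hyp_metric p (hgrad (graph_fun z) p) (hgrad (graph_fun z) p))"

definition is_princ_curv ::
  "(real^('n::finite) option \<Rightarrow> real) \<Rightarrow> real^'n option \<Rightarrow> real^'n \<Rightarrow> bool" where
  "is_princ_curv z u lam \<longleftrightarrow>
     (let p = z u *\<^sub>R u in
      \<exists>e :: 'n \<Rightarrow> real^('n::finite) option.
        (\<forall>i. dd (graph_fun z) (e i) p = 0) \<and>
        (\<forall>i j. hyp_metric p (e i) (e j) = (if i = j then 1 else 0)) \<and>
        (\<forall>i j. sff z p (e i) (e j) = (if i = j then lam $ i else 0)))"

definition princ_curv :: "(real^('n::finite) option \<Rightarrow> real) \<Rightarrow> real^'n option \<Rightarrow> real^'n" where
  "princ_curv z u = (SOME lam. is_princ_curv z u lam)"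

definition S_m :: "nat \<Rightarrow> real^('n::finite) \<Rightarrow> real" where
  "S_m m lam = (\<Sum>I\<in>{I::'n set. card I = m}. \<Prod>i\<in>I. lam $ i)"

definition H_m :: "nat \<Rightarrow> real^('n::finite) \<Rightarrow> real" where
  "H_m m lam = S_m m lam / real (CARD('n) choose m)"

definition Gamma_m :: "nat \<Rightarrow> (real^('n::finite)) set" where
  "Gamma_m m = \<Union>{C. C \<in> components {lam. H_m m lam > 0} \<and>
                     {lam. \<forall>i. lam $ i > 0} \<subseteq> C}"

definition m_admissible :: "nat \<Rightarrow> (real^('n::finite) option \<Rightarrow> real) \<Rightarrow> bool" where
  "m_admissible m z \<longleftrightarrow>
     (\<forall>u\<in>sphere 0 1. z u > 0) \<and>
     C2_on (- {0}) (\<lambda>x. z (x /\<^sub>R norm x)) \<and>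
     (\<forall>u\<in>sphere 0 1. princ_curv z u \<in> Gamma_m m)"

end

theory Submission
  imports Defs
begin

text \<open>Put \<open>v\<^sub>k = ln (tanh (z\<^sub>k / 2))\<close>. The first and second fundamental forms of the graph of \<open>z\<^sub>k\<close> are
  \<open>sinh\<^sup>2 z\<^sub>k G\<close> and \<open>sinh z\<^sub>k (cosh z\<^sub>k G - D\<^sup>2v\<^sub>k) / w\<close> with \<open>G = e + dv\<^sub>k dv\<^sub>k\<close> and
  \<open>w\<^sup>2 = 1 + |dv\<^sub>k|\<^sup>2\<close>. At a maximum point of \<open>v\<^sub>2 - v\<^sub>1\<close> the differentials agree and
  \<open>D\<^sup>2v\<^sub>2 \<le> D\<^sup>2v\<^sub>1\<close>. If \<open>z\<^sub>2 > z\<^sub>1\<close> there, then, because of the strictly increasing factor \<open>cosh\<close>,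
  each scaled curvature \<open>sinh z\<^sub>2 \<lambda>\<^sub>i(z\<^sub>2)\<close> exceeds \<open>sinh z\<^sub>1 \<lambda>\<^sub>i(z\<^sub>1)\<close> (Weyl). Since \<open>S\<^sub>m\<close> is strictly
  increasing on the Garding cone, \<open>\<psi> sinh\<^sup>m\<close> would be larger at \<open>z\<^sub>2\<close> than at \<open>z\<^sub>1\<close>, contrary to the
  monotonicity hypothesis. So \<open>z\<^sub>2 \<le> z\<^sub>1\<close>, and by symmetry \<open>z\<^sub>1 = z\<^sub>2\<close>: the constant is always \<open>1\<close>.\<close>

section \<open>Elementary symmetric polynomials and the Garding cone\<close>

text \<open>An antiderivative of 1 / sinh rho is ln (tanh (rho / 2)). With this function as radial
  coordinate t the metric is sinh^2 rho (dt^2 + e), conformal to a cylinder. Hence, once dv and D^2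
  v are fixed, the height of the graph enters the two forms only through sinh and cosh: multiplying
  the curvatures by sinh z removes the conformal factor, and the coefficient cosh z is the only
  trace of the height that remains. The same multiplication turns H_m = psi into the quantity psi
  sinh^m of the hypothesis. The comparison takes place at a single point, but two obstacles shape
  it. The principal directions of the two graphs there are unrelated, so the curvatures can be
  compared only after a permutation. And \<open>Gamma_m\<close> is given as a connected component,
  which by itself says nothing about the symmetric polynomials of lower degree, whereas monotonicity
  of S_m requires their signs even after a variable has been deleted. Newton's inequality for real
  numbers of arbitrary sign supplies these signs.\<close>

text \<open>The index set is an argument so that variables can be deleted; the ring is arbitrary
  because Newton's inequality is derived from complex arguments.\<close>

definition esym :: "nat \<Rightarrow> 'i set \<Rightarrow> ('i \<Rightarrow> 'a::comm_ring_1) \<Rightarrow> 'a" where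
  "esym k A f = (\<Sum>I | I \<subseteq> A \<and> card I = k. \<Prod>i\<in>I. f i)"

lemma esym_0: "finite A \<Longrightarrow> esym 0 A f = 1"
proof -
  assume "finite A"
  then have "{I. I \<subseteq> A \<and> card I = 0} = {{}}"
    by (auto dest: finite_subset)
  then show ?thesis by (simp add: esym_def)
qed

lemma esym_eq_0:
  assumes "finite A" "card A < k"
  shows "esym k A f = 0"
proof -
  have "{I. I \<subseteq> A \<and> card I = k} = {}"
  proof -
    have "card I \<noteq> k" if "I \<subseteq> A" for I
      using card_mono[OF assms(1) that] assms(2) by simp
    then show ?thesis by blast
  qed
  then show ?thesis by (simp only: esym_def sum.empty)
qed

lemma esym_empty: "esym (Suc k) {} f = 0"
  by (simp add: esym_eq_0)

lemma esym_insert: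
  assumes "finite A" "x \<notin> A"
  shows "esym (Suc k) (insert x A) f = esym (Suc k) A f + f x * esym k A f"
proof -
  let ?S = "\<lambda>k. {I. I \<subseteq> A \<and> card I = k}"
  have fin: "finite (?S k)" for k
    using assms(1) by (auto intro: finite_subset[of _ "Pow A"])
  have eq: "{I. I \<subseteq> insert x A \<and> card I = Suc k} = ?S (Suc k) \<union> insert x ` ?S k"
  proof (intro set_eqI iffI)
    fix I assume I: "I \<in> {I. I \<subseteq> insert x A \<and> card I = Suc k}"
    then have fI: "finite I" using assms(1) by (auto intro: finite_subset)
    show "I \<in> ?S (Suc k) \<union> insert x ` ?S k"
    proof (cases "x \<in> I")
      case True
      then have "I = insert x (I - {x})" "I - {x} \<subseteq> A" "card (I - {x}) = k"
        using I fI by auto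
      then show ?thesis by blast
    next
      case False
      then show ?thesis using I by auto
    qed
  next
    fix I assume "I \<in> ?S (Suc k) \<union> insert x ` ?S k"
    then show "I \<in> {I. I \<subseteq> insert x A \<and> card I = Suc k}"
    proof
      assume "I \<in> insert x ` ?S k"
      then obtain J where J: "I = insert x J" "J \<subseteq> A" "card J = k" by auto
      then have "finite J" "x \<notin> J" using assms by (auto intro: finite_subset)
      then show ?thesis using J by auto
    qed auto
  qed
  have disj: "?S (Suc k) \<inter> insert x ` ?S k = {}" using assms(2) by auto
  have inj: "inj_on (insert x) (?S k)"
    using assms(2) by (auto simp: inj_on_def)
  have "esym (Suc k) (insert x A) f
      = esym (Suc k) A f + (\<Sum>I\<in>insert x ` ?S k. \<Prod>i\<in>I. f i)"
    unfolding esym_def eq using fin disj by (subst sum.union_disjoint) auto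
  also have "(\<Sum>I\<in>insert x ` ?S k. \<Prod>i\<in>I. f i) = (\<Sum>I\<in>?S k. f x * (\<Prod>i\<in>I. f i))"
    unfolding sum.reindex[OF inj] o_def
  proof (rule sum.cong[OF refl])
    fix I assume "I \<in> ?S k"
    then have "finite I" "x \<notin> I" using assms by (auto intro: finite_subset)
    then show "(\<Prod>i\<in>insert x I. f i) = f x * (\<Prod>i\<in>I. f i)" by simp
  qed
  finally show ?thesis by (simp add: esym_def sum_distrib_left)
qed

lemma esym_remove:
  assumes "finite A" "x \<in> A"
  shows "esym (Suc k) A f = esym (Suc k) (A - {x}) f + f x * esym k (A - {x}) f"
  using esym_insert[of "A - {x}" x k f] assms by (simp add: insert_absorb)

lemma esym_cong: "(\<And>i. i \<in> A \<Longrightarrow> f i = g i) \<Longrightarrow> esym k A f = esym k A g"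
  unfolding esym_def by (intro sum.cong prod.cong) auto

section \<open>Euler's identity and Newton's inequalities\<close>

text \<open>Deleting \<open>i\<close> from the index set gives the partial derivative of S_(k+1) in
  the variable \<open>i\<close>, so this is Euler's identity in degree k + 1.\<close>

lemma esym_euler:
  assumes "finite A"
  shows "(\<Sum>i\<in>A. f i * esym k (A - {i}) f) = of_nat (Suc k) * esym (Suc k) A f"
  using assms
proof (induction A arbitrary: k rule: finite_induct)
  case empty
  then show ?case by (simp add: esym_empty)
next
  case (insert x A)
  have *: "esym k (insert x A - {i}) f =
      (case k of 0 \<Rightarrow> 1 | Suc j \<Rightarrow> esym k (A - {i}) f + f x * esym j (A - {i}) f)"
    if "i \<in> A" for i
  proof -
    have "insert x A - {i} = insert x (A - {i})" using that insert by auto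
    then show ?thesis using insert that
      by (cases k) (auto simp: esym_0 esym_insert)
  qed
  have xA: "insert x A - {x} = A" using insert by auto
  have "(\<Sum>i\<in>insert x A. f i * esym k (insert x A - {i}) f)
    = f x * esym k A f + (\<Sum>i\<in>A. f i * esym k (insert x A - {i}) f)"
    using insert by (simp add: xA)
  also have "(\<Sum>i\<in>A. f i * esym k (insert x A - {i}) f)
     = of_nat (Suc k) * esym (Suc k) A f + f x * (of_nat k * esym k A f)"
  proof (cases k)
    case 0
    then show ?thesis using insert.IH[of 0] insert.hyps by (simp add: * esym_0)
  next
    case (Suc j)
    have "(\<Sum>i\<in>A. f i * esym k (insert x A - {i}) f)
       = (\<Sum>i\<in>A. f i * esym k (A - {i}) f) + f x * (\<Sum>i\<in>A. f i * esym j (A - {i}) f)"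
      unfolding sum_distrib_left sum.distrib[symmetric]
      using *[unfolded Suc] by (intro sum.cong) (auto simp: Suc algebra_simps)
    then show ?thesis using insert.IH[of k] insert.IH[of j] Suc by simp
  qed
  finally show ?case using insert by (simp add: esym_insert algebra_simps)
qed

text \<open>The upper half plane is closed under the parallel sum \<open>1 / (1/z + 1/w)\<close>.\<close>

lemma Im_parallel_sum_pos:
  assumes "Im z > 0" "Im w > 0"
  shows "Im (z * w / (w + z)) > 0"
proof -
  have "z \<noteq> 0" "w \<noteq> 0" using assms by auto
  have inv: "Im (inverse x) < 0 \<longleftrightarrow> Im x > 0" if "x \<noteq> 0" for x :: complex
  proof -
    have "(Re x)\<^sup>2 + (Im x)\<^sup>2 > 0"
      using that by (simp add: complex_eq_iff sum_power2_gt_zero_iff)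
    then show ?thesis by (simp add: zero_less_divide_iff)
  qed
  have ne: "w + z \<noteq> 0" using assms by (auto simp: complex_eq_iff)
  have eq: "z * w / (w + z) = inverse (inverse z + inverse w)"
    using \<open>z \<noteq> 0\<close> \<open>w \<noteq> 0\<close> ne by (simp add: field_simps)
  have s: "Im (inverse z + inverse w) < 0"
    using inv[OF \<open>z \<noteq> 0\<close>] inv[OF \<open>w \<noteq> 0\<close>] assms by (simp only: plus_complex.sel add_neg_neg)
  have "inverse (inverse z + inverse w) \<noteq> 0"
  proof
    assume "inverse (inverse z + inverse w) = 0"
    then have "inverse z + inverse w = 0" by (rule inverse_zero_imp_zero)
    then show False using s by (simp only: zero_complex.sel)
  qed
  from inv[OF this, unfolded inverse_inverse_eq] s show ?thesis unfolding eq by blast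
qed

lemma Im_of_nat_mult: "Im (of_nat n * w) = real n * Im w"
  by simp

text \<open>By Euler's identity and the deletion recursion, (k + 2) S_(k+2) / S_(k+1) is a sum over
  \<open>i\<close> of parallel sums of \<open>z i\<close> with the quotient one degree lower in the
  other variables. Each of them lies in the upper half plane by induction.\<close>

lemma esym_quotient_Im_pos:
  fixes z :: "'i \<Rightarrow> complex"
  assumes "finite A" "Suc k \<le> card A" "\<And>i. i \<in> A \<Longrightarrow> Im (z i) > 0"
  shows "esym k A z \<noteq> 0 \<and> Im (esym (Suc k) A z / esym k A z) > 0"
  using assms
proof (induction k arbitrary: A)
  case 0
  have "of_nat (Suc 0) * esym (Suc 0) A z = (\<Sum>i\<in>A. z i)"
    using esym_euler[OF 0(1), of z 0] 0 by (simp add: esym_0)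
  moreover have "A \<noteq> {}" using 0 by auto
  ultimately show ?case using 0 by (simp add: esym_0 sum_pos)
next
  case (Suc k)
  \<comment> \<open>If this vanished, the quotient one degree lower would be 0 and could not have
    positive imaginary part.\<close>
  have ne: "esym (Suc k) A z \<noteq> 0" using Suc.IH[of A] Suc.prems by auto
  have "of_nat (Suc (Suc k)) * (esym (Suc (Suc k)) A z / esym (Suc k) A z)
      = (\<Sum>i\<in>A. z i * esym (Suc k) (A - {i}) z / esym (Suc k) A z)"
    unfolding sum_divide_distrib[symmetric] esym_euler[OF Suc.prems(1)] by simp
  moreover have "Im (z i * esym (Suc k) (A - {i}) z / esym (Suc k) A z) > 0" if "i \<in> A" for i
  proof -
    let ?B = "A - {i}"
    let ?R = "esym (Suc k) ?B z / esym k ?B z"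
    have IH: "esym k ?B z \<noteq> 0" "Im ?R > 0"
      using Suc.IH[of ?B] Suc.prems that by auto
    have "?R + z i = esym (Suc k) A z / esym k ?B z"
      unfolding esym_remove[OF Suc.prems(1) that, of k z]
      using IH(1) by (simp add: add_divide_distrib)
    then have "z i * esym (Suc k) ?B z / esym (Suc k) A z = z i * ?R / (?R + z i)"
      using IH(1) by simp
    then show ?thesis using Im_parallel_sum_pos[OF Suc.prems(3)[OF that] IH(2)] by (simp only:)
  qed
  moreover have "A \<noteq> {}" using Suc.prems by auto
  ultimately have "Im (of_nat (Suc (Suc k)) * (esym (Suc (Suc k)) A z / esym (Suc k) A z)) > 0"
    using Suc.prems(1) by (simp only: Im_sum) (rule sum_pos)
  then have "real (Suc (Suc k)) * Im (esym (Suc (Suc k)) A z / esym (Suc k) A z) > 0"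
    by (simp only: Im_of_nat_mult)
  then show ?case using ne by (simp add: zero_less_mult_iff del: Im_divide)
qed

text \<open>Each \<open>k\<close>-subset of \<open>A\<close> arises from exactly card A - k larger
  sets by dropping one element. For k > card A the factor is negative, but \<open>esym k A\<close>
  is then 0.\<close>

lemma esym_shift_deriv:
  fixes f :: "'i \<Rightarrow> 'a::real_normed_field"
  assumes "finite A"
  shows "((\<lambda>t. esym (Suc k) A (\<lambda>i. f i + t)) has_field_derivative
     (of_nat (card A) - of_nat k) * esym k A (\<lambda>i. f i + t)) (at t)"
  using assms
proof (induction A arbitrary: k rule: finite_induct)
  case empty
  show ?case by (cases k) (auto simp: esym_empty)
next
  case (insert x A)
  show ?case
  proof (cases k)
    case 0
    have "((\<lambda>t. esym (Suc k) A (\<lambda>i. f i + t) + (f x + t)) has_field_derivative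
       (of_nat (card A) - of_nat k) * esym k A (\<lambda>i. f i + t) + 1) (at t)"
      by (auto intro!: derivative_eq_intros insert)
    then show ?thesis using insert.hyps 0 by (simp add: esym_insert esym_0 add.commute)
  next
    case (Suc j)
    have "((\<lambda>t. esym (Suc k) A (\<lambda>i. f i + t) + (f x + t) * esym k A (\<lambda>i. f i + t)) has_field_derivative
       (of_nat (card A) - of_nat k) * esym k A (\<lambda>i. f i + t) + (esym k A (\<lambda>i. f i + t)
        + (f x + t) * ((of_nat (card A) - of_nat j) * esym j A (\<lambda>i. f i + t)))) (at t)"
      unfolding Suc by (auto intro!: derivative_eq_intros insert simp: Suc)
    then show ?thesis using insert.hyps Suc by (simp add: esym_insert esym_0 algebra_simps)
  qed
qed

lemma of_real_esym: "of_real (esym k A f) = esym k A (\<lambda>i. of_real (f i) :: 'a::{real_algebra_1,comm_ring_1})"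
  unfolding esym_def by simp

lemma Im_complex_of_real_mult: "Im (complex_of_real c * w) = c * Im w"
  by simp

text \<open>The right minus the left side is the derivative at \<open>\<epsilon> = 0\<close> of
  \<open>Im (S\<^sub>k\<^sub>+\<^sub>2 * cnj S\<^sub>k\<^sub>+\<^sub>1)\<close> at the shifted point \<open>f + i \<epsilon>\<close>, which is positive for \<open>\<epsilon> > 0\<close>.\<close>

lemma newton_esym:
  fixes f :: "'i \<Rightarrow> real"
  assumes "finite A" "k + 2 \<le> card A"
  shows "(real (card A) - real k) * (esym (k+2) A f * esym k A f)
     \<le> (real (card A) - real k - 1) * (esym (Suc k) A f)^2"
proof -
  define S where "S = (\<lambda>k z. esym k A (\<lambda>i. complex_of_real (f i) + z))"
  define h where "h = (\<lambda>\<epsilon>. Im (S (k+2) (\<i> * of_real \<epsilon>) * cnj (S (Suc k) (\<i> * of_real \<epsilon>))))"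
  have S0: "S k 0 = of_real (esym k A f)" for k
    unfolding S_def by (simp add: of_real_esym)
  have dS: "((\<lambda>\<epsilon>. S (Suc j) (\<i> * complex_of_real \<epsilon>)) has_vector_derivative
      \<i> * of_real ((real (card A) - real j) * esym j A f)) (at 0)" for j
  proof -
    have "(S (Suc j) has_field_derivative (of_nat (card A) - of_nat j) * S j 0) (at (\<i> * complex_of_real 0))"
      unfolding S_def using esym_shift_deriv[OF assms(1), of j "\<lambda>i. complex_of_real (f i)" 0] by simp
    moreover have "((\<lambda>\<epsilon>. \<i> * complex_of_real \<epsilon>) has_vector_derivative \<i>) (at 0)"
      by (auto intro!: derivative_eq_intros)
    ultimately have "(S (Suc j) \<circ> (\<lambda>\<epsilon>. \<i> * complex_of_real \<epsilon>) has_vector_derivative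
        \<i> * ((of_nat (card A) - of_nat j) * S j 0)) (at 0)"
      using field_vector_diff_chain_at by blast
    then show ?thesis by (simp add: o_def S0)
  qed
  have cnj': "((\<lambda>\<epsilon>. cnj (S (Suc k) (\<i> * complex_of_real \<epsilon>))) has_vector_derivative
      cnj (\<i> * of_real ((real (card A) - real k) * esym k A f))) (at 0)"
    using dS[of k] by (rule has_vector_derivative_cnj)
  have k2: "k + 2 = Suc (Suc k)" by simp
  have "((\<lambda>\<epsilon>. S (k+2) (\<i> * of_real \<epsilon>) * cnj (S (Suc k) (\<i> * of_real \<epsilon>))) has_vector_derivative
     S (k+2) 0 * cnj (\<i> * of_real ((real (card A) - real k) * esym k A f)) +
     \<i> * of_real ((real (card A) - real (Suc k)) * esym (Suc k) A f) * cnj (S (Suc k) 0)) (at 0)"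
    using has_vector_derivative_mult[OF dS[of "Suc k"] cnj'] by simp
  then have "(h has_real_derivative Im (S (k+2) 0 * cnj (\<i> * of_real ((real (card A) - real k) * esym k A f)) +
     \<i> * of_real ((real (card A) - real (Suc k)) * esym (Suc k) A f) * cnj (S (Suc k) 0))) (at 0)"
    unfolding h_def has_real_derivative_iff_has_vector_derivative by (rule bounded_linear.has_vector_derivative[OF bounded_linear_Im])
  then have dh: "(h has_real_derivative
     (real (card A) - real k - 1) * (esym (Suc k) A f)^2 - (real (card A) - real k) * (esym (k+2) A f * esym k A f)) (at 0)"
    unfolding S0 by (simp add: power2_eq_square algebra_simps)
  have h0: "h 0 = 0" unfolding h_def by (simp add: S0)
  have pos: "h \<epsilon> > 0" if "\<epsilon> > 0" for \<epsilon>
  proof -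
    let ?z = "\<lambda>i. complex_of_real (f i) + \<i> * of_real \<epsilon>"
    have q: "esym (Suc k) A ?z \<noteq> 0" "Im (esym (k+2) A ?z / esym (Suc k) A ?z) > 0"
      using esym_quotient_Im_pos[of A "Suc k" ?z] assms that by auto
    have "esym (k+2) A ?z * cnj (esym (Suc k) A ?z)
        = of_real ((cmod (esym (Suc k) A ?z))^2) * (esym (k+2) A ?z / esym (Suc k) A ?z)"
      using q(1) by (subst complex_div_cnj) simp
    then have "h \<epsilon> = Im (of_real ((cmod (esym (Suc k) A ?z))^2) * (esym (k+2) A ?z / esym (Suc k) A ?z))"
      unfolding h_def S_def by (simp only:)
    then have "h \<epsilon> = (cmod (esym (Suc k) A ?z))^2 * Im (esym (k+2) A ?z / esym (Suc k) A ?z)"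
      by (simp only: Im_complex_of_real_mult)
    then show ?thesis using q by simp
  qed
  \<comment> \<open>At 0 both factors of \<open>h\<close> are real, so \<open>h 0 = 0\<close>; a
    negative derivative there would make \<open>h\<close> negative just to the right.\<close>
  show ?thesis
  proof (rule ccontr)
    assume "\<not> ?thesis"
    then obtain d where d: "d > 0" "\<And>e. e > 0 \<Longrightarrow> e < d \<Longrightarrow> h 0 > h (0 + e)"
      using DERIV_neg_dec_right[OF dh] by auto
    have "h 0 > h (0 + d/2)" by (rule d(2)) (use d(1) in auto)
    moreover have "h (d/2) > 0" by (rule pos) (use d(1) in auto)
    ultimately show False using h0 by simp
  qed
qed

text \<open>The sharp constants are given up for a form without a lower bound on
  \<open>card A\<close>, which stays applicable after a variable has been deleted.\<close>

lemma newton_esym_weak: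
  fixes f :: "'i \<Rightarrow> real"
  assumes "finite A"
  shows "esym (k+2) A f * esym k A f \<le> (esym (Suc k) A f)\<^sup>2"
proof (cases "k + 2 \<le> card A")
  case True
  let ?N = "real (card A) - real k"
  have N: "?N > 0" using True by simp
  have "?N * (esym (k+2) A f * esym k A f) \<le> (?N - 1) * (esym (Suc k) A f)\<^sup>2"
    using newton_esym[OF assms True] .
  also have "\<dots> \<le> ?N * (esym (Suc k) A f)\<^sup>2" by (rule mult_right_mono) auto
  finally show ?thesis using N by simp
next
  case False
  then have "esym (k+2) A f = 0" using assms by (intro esym_eq_0) auto
  then show ?thesis by simp
qed

lemma esym_ge_power:
  fixes f :: "'i \<Rightarrow> real"
  assumes "finite A" "m \<le> card A" "s \<ge> 0" "\<And>i. i \<in> A \<Longrightarrow> s \<le> f i"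
  shows "s ^ m \<le> esym m A f"
proof -
  obtain I where I: "I \<subseteq> A" "card I = m"
    using assms(1,2) by (meson obtain_subset_with_card_n)
  have "s ^ m = (\<Prod>i\<in>I. s)" using I by simp
  also have "\<dots> \<le> (\<Prod>i\<in>I. f i)" using assms I by (intro prod_mono) auto
  also have "\<dots> \<le> esym m A f"
    unfolding esym_def
  proof (rule member_le_sum[of I _ "\<lambda>I. \<Prod>i\<in>I. f i"])
    show "finite {I. I \<subseteq> A \<and> card I = m}"
      using assms(1) by (auto intro: finite_subset[of _ "Pow A"])
    fix J assume "J \<in> {I. I \<subseteq> A \<and> card I = m} - {I}"
    then show "0 \<le> prod f J" using assms(3,4) by (auto intro!: prod_nonneg intro: order_trans)
  qed (use I in auto)
  finally show ?thesis .
qed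

text \<open>Newton's inequality makes \<open>\<phi> t = S\<^sub>m (f + t)\<close> log-concave where it is positive. Being unbounded
  on the half line, it must then be strictly increasing, and its derivative is a multiple of the
  elementary symmetric polynomial of one degree less.\<close>

lemma esym_pos_lower:
  fixes f :: "'i \<Rightarrow> real"
  assumes A: "finite A" "Suc m \<le> card A"
    and pos: "\<And>t. t \<ge> 0 \<Longrightarrow> esym (Suc m) A (\<lambda>i. f i + t) > 0"
  shows "esym m A f > 0"
proof (cases m)
  case 0
  then show ?thesis by (simp add: esym_0 A)
next
  case (Suc k)
  let ?n = "real (card A)"
  define S where "S = (\<lambda>j t. esym j A (\<lambda>i. f i + t))"
  have dS: "(S (Suc j) has_real_derivative (?n - real j) * S j t) (at t)" for j t
    unfolding S_def by (rule esym_shift_deriv[OF A(1)])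
  \<comment> \<open>Up to the constant factor \<open>?n - real m\<close> this is the logarithmic
    derivative of \<open>S (Suc m)\<close>; that \<open>q\<close> decreases is the
    log-concavity.\<close>
  define q where "q = (\<lambda>t. S (Suc k) t / S (Suc m) t)"
  have mk: "?n - real k > 1" using A Suc by simp
  have S_pos: "S (Suc m) t > 0" if "t \<ge> 0" for t using pos[OF that] by (simp add: S_def)
  have dq: "\<exists>y. (q has_real_derivative y) (at t) \<and> y \<le> 0" if "t \<ge> 0" for t
  proof -
    have "(q has_real_derivative ((?n - real k) * S k t * S (Suc m) t - S (Suc k) t * ((?n - real m) * S m t))
        / (S (Suc m) t * S (Suc m) t)) (at t)"
      unfolding q_def using S_pos[OF that] by (intro DERIV_divide dS) auto
    moreover have "(?n - real k) * S k t * S (Suc m) t \<le> S (Suc k) t * ((?n - real m) * S m t)"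
      using newton_esym[OF A(1), of k "\<lambda>i. f i + t"] A Suc
      by (simp add: S_def power2_eq_square algebra_simps)
    ultimately show ?thesis
      using S_pos[OF that] by (auto simp: divide_nonpos_pos)
  qed
  show ?thesis
  proof (rule ccontr)
    assume "\<not> ?thesis"
    then have "q 0 \<le> 0"
      unfolding q_def using S_pos[of 0] Suc by (intro divide_nonpos_pos) (auto simp: S_def)
    have S_nonpos: "S (Suc k) t \<le> 0" if "t \<ge> 0" for t
    proof -
      have "q t \<le> q 0" using DERIV_nonpos_imp_nonincreasing[OF that, of q] dq by auto
      then have "q t \<le> 0" using \<open>q 0 \<le> 0\<close> by simp
      then show ?thesis using S_pos[OF that] unfolding q_def by (simp add: divide_le_0_iff)
    qed
    have bound: "S (Suc m) t \<le> S (Suc m) 0" if "t \<ge> 0" for t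
    proof (rule DERIV_nonpos_imp_nonincreasing[OF that])
      fix x :: real assume "0 \<le> x"
      then have "(?n - real m) * S m x \<le> 0"
        using S_nonpos[of x] A Suc by (simp add: mult_nonneg_nonpos)
      then show "\<exists>y. (S (Suc m) has_real_derivative y) (at x) \<and> y \<le> 0" using dS by blast
    qed
    \<comment> \<open>After the shift by \<open>t\<close> all variables are at least
      \<open>s\<close>, so \<open>S (Suc m) t\<close> is at least s^(m+1), hence at least
      \<open>s\<close>, which exceeds the bound \<open>S (Suc m) 0\<close> by 1.\<close>
    define s where "s = 1 + S (Suc m) 0"
    define t where "t = s + (\<Sum>i\<in>A. \<bar>f i\<bar>)"
    have s: "s \<ge> 1" using S_pos[of 0] by (simp add: s_def)
    have "s \<le> f i + t" if "i \<in> A" for i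
    proof -
      have "\<bar>f i\<bar> \<le> (\<Sum>i\<in>A. \<bar>f i\<bar>)" using that A(1) by (intro member_le_sum) auto
      then show ?thesis by (simp add: t_def)
    qed
    then have "s ^ Suc m \<le> S (Suc m) t"
      unfolding S_def using A s by (intro esym_ge_power) auto
    moreover have "s ^ 1 \<le> s ^ Suc m" using s by (intro power_increasing) auto
    moreover have "t \<ge> 0" using s by (simp add: t_def sum_nonneg add_nonneg_nonneg)
    ultimately show False using bound[of t] by (simp add: s_def)
  qed
qed

section \<open>The Garding cone and monotonicity on it\<close>

definition garding :: "nat \<Rightarrow> 'i set \<Rightarrow> ('i \<Rightarrow> real) \<Rightarrow> bool" where
  "garding m A f \<longleftrightarrow> (\<forall>j\<le>m. esym j A f > 0)"

text \<open>The degree is lowered one step at a time. Positivity is carried along the whole ray,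
  because every later point of the ray starts a ray of its own, to which
  \<open>esym_pos_lower\<close> applies again.\<close>

lemma gardingI_ray:
  assumes "finite A" "m \<le> card A" "\<And>t. t \<ge> 0 \<Longrightarrow> esym m A (\<lambda>i. f i + t) > 0"
  shows "garding m A f"
proof -
  have "\<forall>t\<ge>0. esym (m - k) A (\<lambda>i. f i + t) > 0" if "k \<le> m" for k
    using that
  proof (induction k)
    case 0
    then show ?case using assms(3) by simp
  next
    case (Suc k)
    have mk: "Suc (m - Suc k) = m - k" using Suc.prems by simp
    show ?case
    proof (intro allI impI)
      fix t :: real assume t: "t \<ge> 0"
      have "esym (Suc (m - Suc k)) A (\<lambda>i. (f i + t) + s) > 0" if "s \<ge> 0" for s
        using Suc.IH Suc.prems t that unfolding mk by (auto simp: add.assoc)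
      then show "esym (m - Suc k) A (\<lambda>i. f i + t) > 0"
        by (rule esym_pos_lower[rotated 2]) (use assms(1,2) Suc.prems in auto)
    qed
  qed
  note ray = this
  have "esym j A f > 0" if "j \<le> m" for j
    using ray[of "m - j"] that by (auto dest: spec[of _ 0])
  then show ?thesis unfolding garding_def by blast
qed

lemma esym_shift_ge:
  fixes f :: "'i \<Rightarrow> real"
  assumes "finite A" "m \<le> card A" "\<And>j. j \<le> m \<Longrightarrow> esym j A f \<ge> 0" "j \<le> m" "t \<ge> 0"
  shows "esym j A f \<le> esym j A (\<lambda>i. f i + t)"
  using assms(4,5)
proof (induction j arbitrary: t)
  case 0
  then show ?case by (simp add: assms esym_0)
next
  case (Suc j)
  have "esym (Suc j) A (\<lambda>i. f i + 0) \<le> esym (Suc j) A (\<lambda>i. f i + t)"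
  proof (rule DERIV_nonneg_imp_nondecreasing[OF Suc.prems(2)])
    fix x :: real assume x: "0 \<le> x"
    have "0 \<le> esym j A (\<lambda>i. f i + x)"
      using Suc.IH[of x] assms(3)[of j] x Suc.prems by auto
    then show "\<exists>y. ((\<lambda>t. esym (Suc j) A (\<lambda>i. f i + t)) has_real_derivative y) (at x) \<and> 0 \<le> y"
      using esym_shift_deriv[OF assms(1), of j f x] assms(2) Suc.prems
      by (intro exI[of _ "(real (card A) - real j) * esym j A (\<lambda>i. f i + x)"] conjI mult_nonneg_nonneg) auto
  qed
  then show ?case by simp
qed

lemma gardingI_nonneg:
  assumes "finite A" "m \<le> card A" "\<And>j. j \<le> m \<Longrightarrow> esym j A f \<ge> 0" "esym m A f > 0"
  shows "garding m A f"
  using assms esym_shift_ge[OF assms(1-3) order_refl]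
  by (intro gardingI_ray) (auto intro: less_le_trans)

text \<open>A clopen argument. The strict inequalities make the cone open; inside \<open>C\<close>,
  where S_m > 0, they may be relaxed to weak ones by \<open>gardingI_nonneg\<close>, so the cone is
  also relatively closed. It contains the vector 1.\<close>

lemma garding_connected:
  fixes C :: "(real^'n::finite) set"
  assumes "m \<le> CARD('n)" "connected C"
    and pos: "\<And>x. x \<in> C \<Longrightarrow> esym m UNIV (($) x) > 0"
    and one: "1 \<in> C" and lam: "lam \<in> C"
  shows "garding m UNIV (($) lam)"
proof -
  have cont: "continuous_on UNIV (\<lambda>x::real^'n. esym j UNIV (($) x))" for j
    unfolding esym_def by (intro continuous_intros)
  define G where "G = {x::real^'n. garding m UNIV (($) x)}"
  have G: "G = (\<Inter>j\<in>{..m}. {x. esym j UNIV (($) x) > 0})"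
    by (auto simp: G_def garding_def)
  have "open G" unfolding G
    by (intro open_INT ballI finite_atMost open_Collect_less cont continuous_on_const)
  define G' where "G' = (\<Inter>j\<in>{..m}. {x::real^'n. esym j UNIV (($) x) \<ge> 0})"
  have "closed G'" unfolding G'_def
    by (intro closed_INT ballI closed_Collect_le cont continuous_on_const)
  have eq: "C \<inter> G = C \<inter> G'"
  proof (intro set_eqI iffI)
    fix x assume "x \<in> C \<inter> G'"
    then show "x \<in> C \<inter> G"
      using assms(1) pos unfolding G_def G'_def by (auto intro!: gardingI_nonneg)
  qed (auto simp: G G'_def less_imp_le)
  have "openin (top_of_set C) (C \<inter> G)" using \<open>open G\<close> by (rule openin_open_Int)
  moreover have "closedin (top_of_set C) (C \<inter> G)"
    unfolding eq using \<open>closed G'\<close> by (rule closedin_closed_Int)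
  ultimately have "C \<inter> G = {} \<or> C \<inter> G = C"
    using assms(2) connected_clopen by blast
  moreover have "1 \<in> G"
  proof -
    have "esym j UNIV (($) (1::real^'n)) \<ge> 1 ^ j" if "j \<le> m" for j
      using that assms(1) by (intro esym_ge_power) auto
    then show ?thesis by (auto simp: G_def garding_def intro: less_le_trans[OF zero_less_one])
  qed
  ultimately show ?thesis using one lam by (auto simp: G_def)
qed

text \<open>If \<open>S\<^sub>k\<^sub>+\<^sub>1 \<le> 0\<close> after the removal of one variable while \<open>S\<^sub>k > 0\<close>, positivity of the full
  polynomials of degrees \<open>k + 1\<close> and \<open>k + 2\<close> contradicts Newton's inequality.\<close>

lemma garding_remove:
  assumes "finite A" "garding m A f" "i \<in> A" "k < m"
  shows "esym k (A - {i}) f > 0"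
  using assms(4)
proof (induction k)
  case 0
  then show ?case by (simp add: esym_0 assms)
next
  case (Suc k)
  define a b c x where abcx: "a = esym k (A - {i}) f" "b = esym (Suc k) (A - {i}) f"
    "c = esym (k + 2) (A - {i}) f" "x = f i"
  have "a > 0" using Suc by (simp add: abcx)
  have "esym (Suc k) A f > 0" "esym (Suc (Suc k)) A f > 0"
    using assms(2) Suc.prems by (auto simp: garding_def)
  then have 1: "b + x * a > 0" and 2: "c + x * b > 0"
    unfolding esym_remove[OF assms(1,3)] abcx by simp_all
  have 3: "c * a \<le> b\<^sup>2"
    unfolding abcx using assms(1) by (intro newton_esym_weak) simp
  show ?case
  proof (rule ccontr)
    assume "\<not> ?case"
    then have b: "b \<le> 0" by (simp add: abcx)
    have "(- b) * (- b) \<le> (- b) * (x * a)" using 1 b by (intro mult_left_mono) auto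
    moreover have "(- (x * b)) * a < c * a" using 2 \<open>a > 0\<close> by (intro mult_strict_right_mono) auto
    ultimately show False using 3 by (simp add: power2_eq_square algebra_simps)
  qed
qed

text \<open>As a function of one variable each symmetric polynomial is affine, and its slope is the
  polynomial of the remaining variables, positive by \<open>garding_remove\<close>. That the new
  point stays in the cone allows the variables to be raised one after another.\<close>

lemma garding_update:
  assumes "finite A" "garding m A f" "i \<in> A" "f i \<le> g i" "\<And>j. j \<in> A - {i} \<Longrightarrow> g j = f j"
  shows "garding m A g" "esym m A f \<le> esym m A g" "m \<ge> 1 \<Longrightarrow> f i < g i \<Longrightarrow> esym m A f < esym m A g"
proof -
  have eq: "esym (Suc j) A g = esym (Suc j) A f + (g i - f i) * esym j (A - {i}) f" for j
  proof -
    have c: "esym j (A - {i}) g = esym j (A - {i}) f" for j using assms(5) by (rule esym_cong)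
    show ?thesis
      unfolding esym_remove[OF assms(1,3), of j] c by (simp add: algebra_simps)
  qed
  have rem: "esym j (A - {i}) f > 0" if "j < m" for j
    using garding_remove[OF assms(1-3) that] .
  have ge: "esym j A f \<le> esym j A g" if "j \<le> m" for j
  proof (cases j)
    case (Suc k)
    then have "esym k (A - {i}) f \<ge> 0" using rem[of k] that by simp
    then show ?thesis using assms(4) by (simp add: Suc eq)
  qed (simp add: esym_0 assms(1))
  show "garding m A g" using assms(2) ge unfolding garding_def by (auto intro: less_le_trans)
  show "esym m A f \<le> esym m A g" by (rule ge) simp
  show "esym m A f < esym m A g" if "m \<ge> 1" "f i < g i"
    using that rem by (cases m) (auto simp: eq)
qed

lemma garding_mono:
  assumes "finite A" "garding m A f" "\<And>i. i \<in> A \<Longrightarrow> f i \<le> g i"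
  shows "esym m A f \<le> esym m A g"
proof -
  have "garding m A (\<lambda>i. if i \<in> B then g i else f i) \<and>
      esym m A f \<le> esym m A (\<lambda>i. if i \<in> B then g i else f i)" if "B \<subseteq> A" for B
    using finite_subset[OF that assms(1)] that
  proof (induction B rule: finite_induct)
    case empty
    then show ?case using assms(2) by simp
  next
    case (insert i B)
    note u = garding_update[OF assms(1), of m "\<lambda>j. if j \<in> B then g j else f j" i
        "\<lambda>j. if j \<in> insert i B then g j else f j"]
    show ?case using u(1,2) insert assms(3) by (auto intro: order_trans)
  qed
  from this[of A] have "esym m A f \<le> esym m A (\<lambda>i. if i \<in> A then g i else f i)" by simp
  also have "\<dots> = esym m A g" by (rule esym_cong) simp
  finally show ?thesis .
qed

lemma garding_strict_mono:
  assumes "finite A" "garding m A f" "1 \<le> m" "A \<noteq> {}" "\<And>i. i \<in> A \<Longrightarrow> f i < g i"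
  shows "esym m A f < esym m A g"
proof -
  obtain i where i: "i \<in> A" using assms(4) by auto
  let ?h = "f(i := g i)"
  have "garding m A ?h" "esym m A f < esym m A ?h"
    using garding_update[of A m f i ?h] assms i by (auto simp: less_imp_le)
  moreover have "esym m A ?h \<le> esym m A g"
    using calculation(1) assms by (intro garding_mono) (auto simp: less_imp_le)
  ultimately show ?thesis by simp
qed

lemma esym_scale:
  "esym k A (\<lambda>i. c * f i) = c ^ k * esym k A f"
  unfolding esym_def sum_distrib_left
  by (rule sum.cong) (auto simp: prod.distrib)

lemma esym_image:
  assumes "finite A" "inj_on \<pi> A"
  shows "esym k (\<pi> ` A) f = esym k A (\<lambda>i. f (\<pi> i))"
  using assms
proof (induction A arbitrary: k rule: finite_induct)
  case empty
  then show ?case by (cases k) (auto simp: esym_0 esym_empty)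
next
  case (insert x A)
  then show ?case by (cases k) (auto simp: esym_0 esym_insert)
qed

lemma garding_scale: "c > 0 \<Longrightarrow> garding m A f \<Longrightarrow> garding m A (\<lambda>i. c * f i)"
  by (simp add: garding_def esym_scale)

lemma S_m_esym: "S_m m lam = esym m UNIV (($) lam)"
  by (simp add: S_m_def esym_def)

lemma Gamma_m_garding:
  assumes "m \<le> CARD('n)" "lam \<in> (Gamma_m m :: (real^'n::finite) set)"
  shows "garding m UNIV (($) lam)"
proof -
  obtain C where C: "C \<in> components {lam :: real^'n. H_m m lam > 0}"
    "{lam. \<forall>i. lam $ i > 0} \<subseteq> C" "lam \<in> C"
    using assms(2) by (auto simp: Gamma_m_def)
  have "real (CARD('n) choose m) > 0" using assms(1) by simp
  then have "esym m UNIV (($) x) > 0" if "x \<in> C" for x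
    using that in_components_subset[OF C(1)] by (auto simp: H_m_def S_m_esym zero_less_divide_iff)
  moreover have "1 \<in> C" using C(2) by auto
  ultimately show ?thesis
    using assms(1) in_components_connected[OF C(1)] C(3) by (intro garding_connected) auto
qed

section \<open>Eigenvalues relative to an inner product\<close>

lemma finite_has_max:
  fixes f :: "'i \<Rightarrow> 'a::linorder"
  assumes "finite X" "X \<noteq> {}"
  shows "\<exists>i\<in>X. \<forall>k\<in>X. f k \<le> f i"
proof -
  have "Max (f ` X) \<in> f ` X" using assms by (intro Max_in) auto
  then obtain i where "i \<in> X" "f i = Max (f ` X)" by force
  then show ?thesis using assms by (intro bexI[of _ i]) auto
qed

text \<open>A largest \<open>a\<close> is matched with a largest \<open>b\<close>. Removing this
  pair preserves the comparison of counts: for thresholds up to the removed \<open>a\<close> both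
  counts drop by one, and above it no \<open>a\<close> is left to count.\<close>

lemma matching_from_counts:
  fixes a :: "'i \<Rightarrow> real" and b :: "'j \<Rightarrow> real"
  assumes "finite A" "finite B" "card A = card B"
    and "\<And>s. card {i \<in> A. s \<le> a i} \<le> card {j \<in> B. s \<le> b j}"
  shows "\<exists>\<pi>. bij_betw \<pi> A B \<and> (\<forall>i\<in>A. a i \<le> b (\<pi> i))"
  using assms
proof (induction "card A" arbitrary: A B)
  case 0
  then have "A = {}" "B = {}" by auto
  then show ?case by (auto simp: bij_betw_def)
next
  case (Suc n)
  then have ne: "A \<noteq> {}" "B \<noteq> {}" by auto
  obtain i where i: "i \<in> A" "\<And>k. k \<in> A \<Longrightarrow> a k \<le> a i"
    using finite_has_max[OF Suc.prems(1) ne(1), of a] by blast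
  obtain j where j: "j \<in> B" "\<And>k. k \<in> B \<Longrightarrow> b k \<le> b j"
    using finite_has_max[OF Suc.prems(2) ne(2), of b] by blast
  have "i \<in> {k \<in> A. a i \<le> a k}" using i by simp
  then have "card {k \<in> A. a i \<le> a k} > 0"
    using Suc.prems(1) card_gt_0_iff by fastforce
  then have "card {k \<in> B. a i \<le> b k} > 0" using Suc.prems(4)[of "a i"] by simp
  then obtain k where "k \<in> B" "a i \<le> b k" by (auto simp: card_gt_0_iff)
  then have ij: "a i \<le> b j" using j(2) by (meson order_trans)
  have "card {k \<in> A - {i}. s \<le> a k} \<le> card {k \<in> B - {j}. s \<le> b k}" for s
  proof (cases "s \<le> a i")
    case True
    have "{k \<in> A - {i}. s \<le> a k} = {k \<in> A. s \<le> a k} - {i}"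
      "{k \<in> B - {j}. s \<le> b k} = {k \<in> B. s \<le> b k} - {j}" by auto
    moreover have "i \<in> {k \<in> A. s \<le> a k}" "j \<in> {k \<in> B. s \<le> b k}"
      using True ij i(1) j(1) by auto
    ultimately show ?thesis
      using Suc.prems(4)[of s] by (simp only: card_Diff_singleton diff_le_mono)
  next
    case False
    then have "{k \<in> A - {i}. s \<le> a k} = {}" using i(2) by force
    then show ?thesis by (simp only: card.empty le0)
  qed
  moreover have "n = card (A - {i})" "card (A - {i}) = card (B - {j})"
    using Suc.hyps(2)[symmetric] Suc.prems(3) i(1) j(1) by simp_all
  ultimately obtain \<pi> where \<pi>: "bij_betw \<pi> (A - {i}) (B - {j})" "\<forall>k\<in>A - {i}. a k \<le> b (\<pi> k)"
    using Suc.hyps(1)[of "A - {i}" "B - {j}"] Suc.prems(1,2) by blast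
  have "bij_betw (\<pi>(i := j)) (insert i (A - {i})) (insert j (B - {j}))"
  proof (rule bij_betw_combine[of _ "{i}" "{j}", simplified])
    show "bij_betw (\<pi>(i := j)) (A - {i}) (B - {j})"
      using \<pi>(1) by (subst bij_betw_cong[of _ _ \<pi>]) auto
  qed (auto simp: bij_betw_def)
  then have "bij_betw (\<pi>(i := j)) A B" using i(1) j(1) by (simp add: insert_absorb)
  moreover have "\<forall>k\<in>A. a k \<le> b ((\<pi>(i := j)) k)" using \<pi>(2) ij by auto
  ultimately show ?case by blast
qed

lemma bilinear_orthonormal_sum:
  fixes B :: "'a::real_vector \<Rightarrow> 'a \<Rightarrow> real" and e :: "'n \<Rightarrow> 'a"
  assumes "bilinear B" "\<And>i j. B (e i) (e j) = (if i = j then \<mu> i else 0)" "finite J"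
  shows "B (\<Sum>i\<in>J. c i *\<^sub>R e i) (\<Sum>i\<in>J. c i *\<^sub>R e i) = (\<Sum>i\<in>J. (c i)\<^sup>2 * \<mu> i)"
proof -
  have "B (\<Sum>i\<in>J. c i *\<^sub>R e i) (\<Sum>i\<in>J. c i *\<^sub>R e i) = (\<Sum>i\<in>J. \<Sum>j\<in>J. c i * c j * B (e i) (e j))"
    using assms(1,3)
    by (simp add: bilinear_sum sum.cartesian_product bilinear_lmul bilinear_rmul case_prod_unfold mult.assoc)
  also have "\<dots> = (\<Sum>i\<in>J. (c i)\<^sup>2 * \<mu> i)"
    using assms(3) by (simp add: assms(2) if_distrib sum.delta power2_eq_square cong: if_cong)
  finally show ?thesis .
qed

section \<open>Eigenvalue comparison and simultaneous diagonalization\<close>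

locale orthonormal_family =
  fixes G :: "'a::euclidean_space \<Rightarrow> 'a \<Rightarrow> real" and e :: "'n::finite \<Rightarrow> 'a"
  assumes bil: "bilinear G" and on: "\<And>i j. G (e i) (e j) = (if i = j then 1 else 0)"
begin

lemma inj_e: "inj e"
proof (rule injI)
  fix i j assume "e i = e j"
  then have "G (e i) (e j) = G (e i) (e i)" by simp
  then show "i = j" by (simp add: on split: if_splits)
qed

lemma coeff:
  assumes "j \<in> J" shows "G (e j) (\<Sum>i\<in>J. c i *\<^sub>R e i) = c j"
proof -
  have "linear (G (e j))" using bil by (simp add: bilinear_def)
  then have "G (e j) (\<Sum>i\<in>J. c i *\<^sub>R e i) = (\<Sum>i\<in>J. c i * G (e j) (e i))"
    by (simp add: linear_sum linear_cmul)
  then show ?thesis using assms by (simp add: on if_distrib cong: if_cong)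
qed

lemma in_span_image: "x \<in> span (e ` J) \<Longrightarrow> \<exists>c. x = (\<Sum>i\<in>J. c i *\<^sub>R e i)"
proof -
  assume "x \<in> span (e ` J)"
  then obtain u where "x = (\<Sum>v\<in>e ` J. u v *\<^sub>R v)" by (auto simp: span_finite)
  then have "x = (\<Sum>i\<in>J. u (e i) *\<^sub>R e i)"
    by (simp add: sum.reindex inj_on_subset[OF inj_e])
  then show ?thesis by (rule exI[of _ "\<lambda>i. u (e i)"])
qed

lemma dim_span_image: "dim (span (e ` J)) = card J"
proof -
  have "independent (e ` J)"
  proof (rule independent_if_scalars_zero)
    fix f x assume s: "(\<Sum>x\<in>e ` J. f x *\<^sub>R x) = 0" and x: "x \<in> e ` J"
    obtain j where j: "j \<in> J" "x = e j" using x by auto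
    have "(\<Sum>i\<in>J. f (e i) *\<^sub>R e i) = 0"
      using s by (simp add: sum.reindex inj_on_subset[OF inj_e])
    then have "f (e j) = G (e j) 0" using coeff[OF j(1), of "f \<circ> e"] by simp
    then show "f x = 0" using j bil by (simp add: bilinear_rzero)
  qed simp
  then show ?thesis
    by (simp add: dim_eq_card_independent card_image inj_on_subset[OF inj_e])
qed

end

text \<open>Weyl's monotonicity of eigenvalues, by comparing, for each threshold \<open>s\<close>, the dimensions of the
  spans of the eigenvectors of \<open>B1\<close> with eigenvalue \<open>\<ge> s\<close> and of those of \<open>B2\<close> with eigenvalue \<open>< s\<close>.\<close>

lemma weyl_monotone:
  fixes G B1 B2 :: "'a::euclidean_space \<Rightarrow> 'a \<Rightarrow> real" and e1 e2 :: "'n::finite \<Rightarrow> 'a"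
  assumes bil: "bilinear G" "bilinear B1" "bilinear B2"
    and T: "subspace T" "dim T = CARD('n)"
    and e: "range e1 \<subseteq> T" "range e2 \<subseteq> T"
    and on: "\<And>i j. G (e1 i) (e1 j) = (if i = j then 1 else 0)"
            "\<And>i j. G (e2 i) (e2 j) = (if i = j then 1 else 0)"
    and diag: "\<And>i j. B1 (e1 i) (e1 j) = (if i = j then \<mu>1 i else 0)"
              "\<And>i j. B2 (e2 i) (e2 j) = (if i = j then \<mu>2 i else 0)"
    and le: "\<And>x. x \<in> T \<Longrightarrow> B1 x x \<le> B2 x x"
  shows "\<exists>\<pi>. bij \<pi> \<and> (\<forall>i. \<mu>1 i \<le> \<mu>2 (\<pi> i))"
proof -
  interpret f1: orthonormal_family G e1 by unfold_locales (fact bil on)+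
  interpret f2: orthonormal_family G e2 by unfold_locales (fact bil on)+
  have "card {i \<in> UNIV. s \<le> \<mu>1 i} \<le> card {i \<in> UNIV. s \<le> \<mu>2 i}" for s
  proof -
    define J where "J = {i. s \<le> \<mu>1 i}"
    define K where "K = {i. \<mu>2 i < s}"
    let ?P = "span (e1 ` J)" and ?N = "span (e2 ` K)"
    have PT: "?P \<subseteq> T" "?N \<subseteq> T" using e T by (intro span_minimal; auto)+
    \<comment> \<open>For x in both spans, s G(x,x) is at most B1(x,x), hence at most B2(x,x), while
      all eigenvalues of \<open>B2\<close> on the second span are below \<open>s\<close>. So every
      coefficient of x vanishes.\<close>
    have "?P \<inter> ?N \<subseteq> {0}"
    proof
      fix x assume x: "x \<in> ?P \<inter> ?N"
      obtain c where c: "x = (\<Sum>i\<in>J. c i *\<^sub>R e1 i)" using f1.in_span_image x by blast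
      obtain d where d: "x = (\<Sum>i\<in>K. d i *\<^sub>R e2 i)" using f2.in_span_image x by blast
      have "s * G x x = (\<Sum>i\<in>J. (c i)\<^sup>2 * s)"
        using bilinear_orthonormal_sum[OF bil(1) on(1), of J c] unfolding c
        by (simp add: sum_distrib_left mult.commute)
      also have "\<dots> \<le> (\<Sum>i\<in>J. (c i)\<^sup>2 * \<mu>1 i)"
        by (intro sum_mono mult_left_mono) (auto simp: J_def)
      also have "\<dots> = B1 x x"
        using bilinear_orthonormal_sum[OF bil(2) diag(1), of J c] unfolding c by simp
      also have "\<dots> \<le> B2 x x" using le x PT by blast
      also have "\<dots> = (\<Sum>i\<in>K. (d i)\<^sup>2 * \<mu>2 i)"
        using bilinear_orthonormal_sum[OF bil(3) diag(2), of K d] unfolding d by simp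
      finally have "s * G x x \<le> (\<Sum>i\<in>K. (d i)\<^sup>2 * \<mu>2 i)" .
      moreover have "s * G x x = (\<Sum>i\<in>K. (d i)\<^sup>2 * s)"
        using bilinear_orthonormal_sum[OF bil(1) on(2), of K d] unfolding d
        by (simp add: sum_distrib_left mult.commute)
      ultimately have le0: "(\<Sum>i\<in>K. (d i)\<^sup>2 * (s - \<mu>2 i)) \<le> 0"
        by (simp add: right_diff_distrib sum_subtractf)
      have nn: "0 \<le> (d i)\<^sup>2 * (s - \<mu>2 i)" if "i \<in> K" for i using that by (simp add: K_def)
      have "(\<Sum>i\<in>K. (d i)\<^sup>2 * (s - \<mu>2 i)) = 0"
        by (rule antisym[OF le0]) (rule sum_nonneg[OF nn])
      then have "\<forall>i\<in>K. (d i)\<^sup>2 * (s - \<mu>2 i) = 0"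
        by (subst (asm) sum_nonneg_eq_0_iff) (use nn in simp_all)
      then have "\<forall>i\<in>K. d i = 0" by (auto simp: K_def)
      then show "x \<in> {0}" unfolding d by simp
    qed
    then have "?P \<inter> ?N = {0}" by (auto intro: span_zero)
    \<comment> \<open>Two subspaces of \<open>T\<close> that meet only in 0 have dimensions adding
      up to at most \<open>CARD('n)\<close>; the complement of \<open>K\<close> is the set counted
      for \<open>B2\<close>.\<close>
    then have "dim ?P + dim ?N = dim {x + y |x y. x \<in> ?P \<and> y \<in> ?N}"
      using dim_sums_Int[OF subspace_span subspace_span, of "e1 ` J" "e2 ` K"] by simp
    also have "\<dots> \<le> dim T" using PT T by (intro dim_subset) (auto intro: subspace_add)
    finally have "card J + card K \<le> CARD('n)" by (simp add: f1.dim_span_image f2.dim_span_image T del: dim_span)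
    moreover have "card (- K) + card K = CARD('n)"
      using card_Un_disjoint[of "- K" K] by simp
    moreover have "- K = {i. s \<le> \<mu>2 i}" by (auto simp: K_def)
    ultimately show ?thesis by (simp add: J_def)
  qed
  then show ?thesis using matching_from_counts[of UNIV UNIV \<mu>1 \<mu>2] by simp
qed

text \<open>The Rayleigh quotient B(x,x) / G(x,x) is maximal at some \<open>e\<close>, with value
  \<open>l\<close>. Then B - l G is nonpositive on \<open>T\<close> and vanishes at (e,e), so it
  annihilates \<open>e\<close> against all of \<open>T\<close>. Hence the
  \<open>G\<close>-orthogonal complement of \<open>e\<close> is also \<open>B\<close>-orthogonal to
  it, and the induction continues there.\<close>

lemma simultaneous_diagonalization:
  fixes G B :: "'a::euclidean_space \<Rightarrow> 'a \<Rightarrow> real"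
  assumes bil: "bilinear G" "bilinear B"
    and T: "subspace T"
    and sym: "\<And>x y. x \<in> T \<Longrightarrow> y \<in> T \<Longrightarrow> G x y = G y x" "\<And>x y. x \<in> T \<Longrightarrow> y \<in> T \<Longrightarrow> B x y = B y x"
    and pos: "\<And>x. x \<in> T \<Longrightarrow> x \<noteq> 0 \<Longrightarrow> G x x > 0"
  shows "\<exists>S\<subseteq>T. finite S \<and> card S = dim T \<and>
     (\<forall>x\<in>S. \<forall>y\<in>S. G x y = (if x = y then 1 else 0)) \<and> (\<forall>x\<in>S. \<forall>y\<in>S. x \<noteq> y \<longrightarrow> B x y = 0)"
  using T sym pos
proof (induction "dim T" arbitrary: T)
  case 0
  then show ?case by (intro exI[of _ "{}"]) auto
next
  case (Suc n)
  have contG: "continuous_on X (\<lambda>x. G x x)" and contB: "continuous_on X (\<lambda>x. B x x)" for X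
    using bilinear_continuous_on_compose[OF continuous_on_id continuous_on_id bil(1)]
      bilinear_continuous_on_compose[OF continuous_on_id continuous_on_id bil(2)] by auto
  have "T \<noteq> {0}" using Suc.hyps(2) by auto
  then obtain w where w: "w \<in> T" "w \<noteq> 0" using Suc.prems(1) subspace_0 by blast
  have nrm: "x /\<^sub>R norm x \<in> T \<inter> sphere 0 1" if "x \<in> T" "x \<noteq> 0" for x
    using that Suc.prems(1) by (auto intro: subspace_scale)
  have cpt: "compact (T \<inter> sphere 0 1)"
    using Suc.prems(1) by (intro closed_Int_compact closed_subspace) auto
  have Gpos: "G x x > 0" if "x \<in> T \<inter> sphere 0 1" for x
    using that by (intro Suc.prems(4)) auto
  have "continuous_on (T \<inter> sphere 0 1) (\<lambda>x. B x x / G x x)"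
    by (intro continuous_on_divide contG contB) (metis Gpos less_irrefl)
  moreover have "T \<inter> sphere 0 1 \<noteq> {}" using nrm[OF w] by blast
  ultimately obtain x0 where x0: "x0 \<in> T \<inter> sphere 0 1"
    and max: "\<And>x. x \<in> T \<inter> sphere 0 1 \<Longrightarrow> B x x / G x x \<le> B x0 x0 / G x0 x0"
    using continuous_attains_sup[OF cpt] by blast
  define l where "l = B x0 x0 / G x0 x0"
  define C where "C = (\<lambda>x y. B x y - l * G x y)"
  have bilC: "C (x + y) z = C x z + C y z" "C z (x + y) = C z x + C z y"
    "C (c *\<^sub>R x) z = c * C x z" "C z (c *\<^sub>R x) = c * C z x" for x y z c
    using bil by (auto simp: C_def bilinear_ladd bilinear_radd bilinear_lmul bilinear_rmul algebra_simps)
  have Csym: "C x y = C y x" if "x \<in> T" "y \<in> T" for x y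
    using Suc.prems(2,3) that by (simp add: C_def)
  have C_le: "C x x \<le> 0" if "x \<in> T" for x
  proof (cases "x = 0")
    case True
    then show ?thesis using bilC(3)[of 0 x x] by simp
  next
    case False
    let ?y = "x /\<^sub>R norm x"
    have "B ?y ?y \<le> l * G ?y ?y"
      using max[OF nrm[OF that False]] Gpos[OF nrm[OF that False]] by (simp add: l_def pos_divide_le_eq)
    then have "C ?y ?y \<le> 0" by (simp add: C_def)
    moreover have "x = norm x *\<^sub>R ?y" using False by simp
    then have "C x x = norm x * (norm x * C ?y ?y)" by (metis bilC(3,4))
    ultimately show ?thesis by (simp add: mult_nonneg_nonpos)
  qed
  define e where "e = x0 /\<^sub>R sqrt (G x0 x0)"
  have eT: "e \<in> T" using x0 Suc.prems(1) by (auto simp: e_def intro: subspace_scale)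
  have Gee: "G e e = 1" using bil(1) Gpos[OF x0]
    by (simp add: e_def bilinear_lmul bilinear_rmul field_simps)
  have "C x0 x0 = 0" using Gpos[OF x0] by (simp add: C_def l_def)
  then have Cee: "C e e = 0" by (simp add: e_def bilC)
  have Cey: "C e y = 0" if y: "y \<in> T" for y
  proof -
    have q: "2 * t * C e y + t\<^sup>2 * C y y \<le> 0" for t
    proof -
      have "C (e + t *\<^sub>R y) (e + t *\<^sub>R y) \<le> 0"
        using eT y Suc.prems(1) by (intro C_le subspace_add subspace_scale)
      then show ?thesis using Csym[OF eT y] Cee by (simp add: bilC power2_eq_square algebra_simps)
    qed
    show ?thesis
    proof (rule ccontr)
      assume ne: "C e y \<noteq> 0"
      \<comment> \<open>A step in the direction where the linear term is positive; the summand 1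
        keeps the denominator positive also when \<open>C y y = 0\<close>. The quadratic becomes t^2
        (2 - C y y) > 0, contradicting \<open>q\<close>.\<close>
      define t where "t = C e y / (1 - C y y)"
      have d: "1 - C y y > 0" using C_le[OF y] by simp
      have "2 * t * C e y + t\<^sup>2 * C y y = t\<^sup>2 * (2 * (1 - C y y) + C y y)"
      proof -
        have "C e y = t * (1 - C y y)" using d by (simp add: t_def)
        then show ?thesis by (simp only:) (simp add: power2_eq_square algebra_simps)
      qed
      moreover have "t\<^sup>2 * (2 * (1 - C y y) + C y y) > 0"
        using d ne C_le[OF y] by (intro mult_pos_pos) (auto simp: t_def)
      ultimately show False using q[of t] by simp
    qed
  qed
  define T' where "T' = {x \<in> T. G e x = 0}"
  have lin: "linear (G e)" using bil(1) by (simp add: bilinear_def)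
  have T': "subspace T'"
    using Suc.prems(1) lin unfolding T'_def subspace_def
    by (auto simp: linear_0 linear_add linear_cmul)
  have sp: "span (insert e T') = T"
  proof
    show "span (insert e T') \<subseteq> T" using eT Suc.prems(1) by (intro span_minimal) (auto simp: T'_def)
    show "T \<subseteq> span (insert e T')"
    proof
      fix x assume x: "x \<in> T"
      have "x - G e x *\<^sub>R e \<in> T'"
        using x eT Suc.prems(1) Gee lin
        by (auto simp: T'_def linear_diff linear_cmul intro!: subspace_diff subspace_scale)
      then have "(x - G e x *\<^sub>R e) + G e x *\<^sub>R e \<in> span (insert e T')"
        by (intro span_add span_scale) (auto intro: span_base)
      then show "x \<in> span (insert e T')" by simp
    qed
  qed
  have eT': "e \<notin> T'" using Gee by (simp add: T'_def)
  have "dim T = dim (insert e T')" using sp dim_span by metis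
  also have "\<dots> = dim T' + 1" using eT' T' by (simp add: dim_insert span_eq_iff[THEN iffD2])
  finally have dimT': "n = dim T'" using Suc.hyps(2) by simp
  obtain S where S: "S \<subseteq> T'" "finite S" "card S = dim T'"
     "\<forall>x\<in>S. \<forall>y\<in>S. G x y = (if x = y then 1 else 0)" "\<forall>x\<in>S. \<forall>y\<in>S. x \<noteq> y \<longrightarrow> B x y = 0"
    using Suc.hyps(1)[OF dimT' T'] Suc.prems(2-4) by (auto simp: T'_def)
  have eS: "e \<notin> S" using eT' S by auto
  have ST: "x \<in> T" "G e x = 0" "G x e = 0" "B e x = 0" "B x e = 0" if "x \<in> S" for x
  proof -
    show x: "x \<in> T" "G e x = 0" using that S by (auto simp: T'_def)
    then show "G x e = 0" using Suc.prems(2) eT by metis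
    show "B e x = 0" using Cey[OF x(1)] x(2) by (simp add: C_def)
    then show "B x e = 0" using Suc.prems(3) eT x by metis
  qed
  show ?case
    using S eS ST eT Gee dimT' Suc.hyps(2)
    by (intro exI[of _ "insert e S"]) auto
qed

section \<open>Second directional derivatives\<close>

lemma dd_eq:
  assumes "(f has_derivative f') (at x)"
  shows "dd f v x = f' v"
proof -
  have l: "((\<lambda>t. x + t *\<^sub>R v) has_derivative (\<lambda>t. t *\<^sub>R v)) (at (0::real))"
    by (auto intro!: derivative_eq_intros)
  have "((\<lambda>t. f (x + t *\<^sub>R v)) has_derivative (\<lambda>t. f' (t *\<^sub>R v))) (at 0)"
    using has_derivative_compose[OF l, of f f'] assms by simp
  moreover have "(\<lambda>t. f' (t *\<^sub>R v)) = (*) (f' v)"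
    using has_derivative_bounded_linear[OF assms] by (auto simp: linear_simps)
  ultimately show ?thesis
    unfolding dd_def by (intro DERIV_imp_deriv) (simp add: has_field_derivative_def)
qed

lemma has_derivative_dd:
  assumes "f differentiable (at x)"
  shows "(f has_derivative (\<lambda>v. dd f v x)) (at x)"
proof -
  obtain f' where f': "(f has_derivative f') (at x)" using assms by (auto simp: differentiable_def)
  then have "(\<lambda>v. dd f v x) = f'" by (auto simp: dd_eq)
  then show ?thesis using f' by simp
qed

lemma linear_dd: "f differentiable (at x) \<Longrightarrow> linear (\<lambda>v. dd f v x)"
  using has_derivative_dd has_derivative_linear by blast

lemma dd_line:
  assumes "f differentiable (at (x + s *\<^sub>R v))"
  shows "((\<lambda>t. f (x + t *\<^sub>R v)) has_real_derivative dd f v (x + s *\<^sub>R v)) (at s)"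
proof -
  have l: "((\<lambda>t. x + t *\<^sub>R v) has_derivative (\<lambda>t. t *\<^sub>R v)) (at s)"
    by (auto intro!: derivative_eq_intros)
  have "((\<lambda>t. f (x + t *\<^sub>R v)) has_derivative (\<lambda>t. dd f (t *\<^sub>R v) (x + s *\<^sub>R v))) (at s)"
    using has_derivative_compose[OF l has_derivative_dd[OF assms]] .
  moreover have "(\<lambda>t. dd f (t *\<^sub>R v) (x + s *\<^sub>R v)) = (*) (dd f v (x + s *\<^sub>R v))"
    by (auto simp: linear_cmul[OF linear_dd[OF assms]])
  ultimately show ?thesis by (simp add: has_field_derivative_def)
qed

lemma dd_basis_expand:
  fixes f :: "'a::euclidean_space \<Rightarrow> real"
  assumes "f differentiable (at x)"
  shows "dd f v x = (\<Sum>b\<in>Basis. (v \<bullet> b) * dd f b x)"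
proof -
  have "dd f (\<Sum>b\<in>Basis. (v \<bullet> b) *\<^sub>R b) x = (\<Sum>b\<in>Basis. (v \<bullet> b) * dd f b x)"
    by (simp add: linear_sum[OF linear_dd[OF assms]] linear_cmul[OF linear_dd[OF assms]])
  then show ?thesis by (simp only: euclidean_representation)
qed

text \<open>Both mixed second derivatives are mean values of the same second difference quotient.\<close>

lemma second_difference_mvt:
  assumes "h > 0"
    and f: "\<And>a b. 0 \<le> a \<Longrightarrow> a \<le> h \<Longrightarrow> 0 \<le> b \<Longrightarrow> b \<le> h \<Longrightarrow> f differentiable (at (x + a *\<^sub>R i + b *\<^sub>R j))"
    and f': "\<And>a b. 0 \<le> a \<Longrightarrow> a \<le> h \<Longrightarrow> 0 \<le> b \<Longrightarrow> b \<le> h \<Longrightarrow> dd f j differentiable (at (x + a *\<^sub>R i + b *\<^sub>R j))"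
  shows "\<exists>a b. 0 < a \<and> a < h \<and> 0 < b \<and> b < h \<and>
    f (x + h *\<^sub>R i + h *\<^sub>R j) - f (x + h *\<^sub>R i) - f (x + h *\<^sub>R j) + f x
      = h\<^sup>2 * dd (dd f j) i (x + a *\<^sub>R i + b *\<^sub>R j)"
proof -
  define \<phi> where "\<phi> = (\<lambda>t. f ((x + h *\<^sub>R i) + t *\<^sub>R j) - f (x + t *\<^sub>R j))"
  have "\<exists>b>0. b < h \<and> \<phi> h - \<phi> 0 = (h - 0) * (dd f j ((x + h *\<^sub>R i) + b *\<^sub>R j) - dd f j (x + b *\<^sub>R j))"
  proof (rule MVT2[OF assms(1)])
    fix t assume "0 \<le> t" "t \<le> h"
    then show "(\<phi> has_real_derivative dd f j ((x + h *\<^sub>R i) + t *\<^sub>R j) - dd f j (x + t *\<^sub>R j)) (at t)"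
      unfolding \<phi>_def using f[of h t] f[of 0 t] assms(1) by (intro DERIV_diff dd_line) auto
  qed
  then obtain b where b: "0 < b" "b < h"
    "\<phi> h - \<phi> 0 = h * (dd f j ((x + h *\<^sub>R i) + b *\<^sub>R j) - dd f j (x + b *\<^sub>R j))" by auto
  define \<xi> where "\<xi> = (\<lambda>t. dd f j ((x + b *\<^sub>R j) + t *\<^sub>R i))"
  have "\<exists>a>0. a < h \<and> \<xi> h - \<xi> 0 = (h - 0) * dd (dd f j) i ((x + b *\<^sub>R j) + a *\<^sub>R i)"
  proof (rule MVT2[OF assms(1)])
    fix t assume "0 \<le> t" "t \<le> h"
    then show "(\<xi> has_real_derivative dd (dd f j) i ((x + b *\<^sub>R j) + t *\<^sub>R i)) (at t)"
      unfolding \<xi>_def using f'[of t b] b by (intro dd_line) (simp add: algebra_simps)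
  qed
  then obtain a where a: "0 < a" "a < h" "\<xi> h - \<xi> 0 = h * dd (dd f j) i ((x + b *\<^sub>R j) + a *\<^sub>R i)" by auto
  have "dd f j ((x + h *\<^sub>R i) + b *\<^sub>R j) - dd f j (x + b *\<^sub>R j) = \<xi> h - \<xi> 0"
    by (simp add: \<xi>_def algebra_simps)
  moreover have "f (x + h *\<^sub>R i + h *\<^sub>R j) - f (x + h *\<^sub>R i) - f (x + h *\<^sub>R j) + f x = \<phi> h - \<phi> 0"
    by (simp add: \<phi>_def)
  ultimately show ?thesis using a b
    by (intro exI[of _ a] exI[of _ b]) (simp add: power2_eq_square add.assoc add.commute[of "b *\<^sub>R j"])
qed

lemma mixed_dd_commute:
  fixes f :: "'a::real_normed_vector \<Rightarrow> real"
  assumes U: "open U" "x \<in> U"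
    and f: "\<And>y. y \<in> U \<Longrightarrow> f differentiable (at y)"
      "\<And>y. y \<in> U \<Longrightarrow> dd f i differentiable (at y)" "\<And>y. y \<in> U \<Longrightarrow> dd f j differentiable (at y)"
    and cont: "continuous_on U (dd (dd f i) j)" "continuous_on U (dd (dd f j) i)"
  shows "dd (dd f i) j x = dd (dd f j) i x"
proof (rule ccontr)
  assume neq: "\<not> ?thesis"
  \<comment> \<open>Half the gap between the two mixed derivatives, so values within this distance
    of them cannot coincide.\<close>
  define \<epsilon> where "\<epsilon> = \<bar>dd (dd f i) j x - dd (dd f j) i x\<bar> / 2"
  have \<epsilon>: "\<epsilon> > 0" using neq by (simp add: \<epsilon>_def)
  obtain r where r: "r > 0" "ball x r \<subseteq> U" using U by (meson open_contains_ball)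
  have "isCont (dd (dd f i) j) x" "isCont (dd (dd f j) i) x"
    using cont U by (auto simp: continuous_on_eq_continuous_at)
  then obtain d1 d2 where d: "d1 > 0" "d2 > 0"
    "\<And>y. dist y x < d1 \<Longrightarrow> \<bar>dd (dd f i) j y - dd (dd f i) j x\<bar> < \<epsilon>"
    "\<And>y. dist y x < d2 \<Longrightarrow> \<bar>dd (dd f j) i y - dd (dd f j) i x\<bar> < \<epsilon>"
    using \<epsilon> unfolding continuous_at_eps_delta dist_real_def by metis
  \<comment> \<open>Small enough for the parallelogram spanned by \<open>h *\<^sub>R i\<close> and
    \<open>h *\<^sub>R j\<close> at \<open>x\<close> to lie in \<open>U\<close> and in both
    continuity neighbourhoods.\<close>
  define h where "h = min r (min d1 d2) / (norm i + norm j + 1)"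
  have N: "norm i + norm j + 1 > 0" by (simp add: add_nonneg_pos)
  have h: "h > 0" using N r d by (simp add: h_def)
  have hN: "h * (norm i + norm j + 1) = min r (min d1 d2)" using N by (simp add: h_def)
  have near: "dist (x + a *\<^sub>R i + b *\<^sub>R j) x < min r (min d1 d2)"
    if "0 \<le> a" "a \<le> h" "0 \<le> b" "b \<le> h" for a b
  proof -
    have "norm (a *\<^sub>R i + b *\<^sub>R j) \<le> h * norm i + h * norm j"
      using that by (intro norm_triangle_le add_mono) (auto intro: mult_right_mono)
    also have "\<dots> < h * (norm i + norm j + 1)" using h by (simp add: algebra_simps)
    finally show ?thesis unfolding hN by (simp add: dist_norm add.assoc)
  qed
  have inU: "x + a *\<^sub>R i + b *\<^sub>R j \<in> U" if "0 \<le> a" "a \<le> h" "0 \<le> b" "b \<le> h" for a b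
    using near[OF that] r(2) by (auto simp: dist_commute)
  obtain a b where ab: "0 < a" "a < h" "0 < b" "b < h"
    "f (x + h *\<^sub>R i + h *\<^sub>R j) - f (x + h *\<^sub>R i) - f (x + h *\<^sub>R j) + f x
      = h\<^sup>2 * dd (dd f j) i (x + a *\<^sub>R i + b *\<^sub>R j)"
    using second_difference_mvt[OF h, of f x i j] f inU by blast
  have "\<exists>b a. 0 < b \<and> b < h \<and> 0 < a \<and> a < h \<and>
    f (x + h *\<^sub>R j + h *\<^sub>R i) - f (x + h *\<^sub>R j) - f (x + h *\<^sub>R i) + f x
      = h\<^sup>2 * dd (dd f i) j (x + b *\<^sub>R j + a *\<^sub>R i)"
  proof (rule second_difference_mvt[OF h])
    fix b a assume "0 \<le> b" "b \<le> h" "0 \<le> a" "a \<le> h"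
    from inU[OF this(3,4) this(1,2)] have "x + b *\<^sub>R j + a *\<^sub>R i \<in> U" by (simp add: algebra_simps)
    then show "f differentiable (at (x + b *\<^sub>R j + a *\<^sub>R i))" "dd f i differentiable (at (x + b *\<^sub>R j + a *\<^sub>R i))"
      using f by auto
  qed
  then obtain b' a' where ab': "0 < b'" "b' < h" "0 < a'" "a' < h"
    "f (x + h *\<^sub>R j + h *\<^sub>R i) - f (x + h *\<^sub>R j) - f (x + h *\<^sub>R i) + f x
      = h\<^sup>2 * dd (dd f i) j (x + b' *\<^sub>R j + a' *\<^sub>R i)" by blast
  have "h\<^sup>2 * dd (dd f i) j (x + b' *\<^sub>R j + a' *\<^sub>R i) = h\<^sup>2 * dd (dd f j) i (x + a *\<^sub>R i + b *\<^sub>R j)"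
    unfolding ab(5)[symmetric] ab'(5)[symmetric] by (simp add: algebra_simps)
  then have "dd (dd f i) j (x + a' *\<^sub>R i + b' *\<^sub>R j) = dd (dd f j) i (x + a *\<^sub>R i + b *\<^sub>R j)"
    using h by (simp add: algebra_simps)
  moreover have "\<bar>dd (dd f i) j (x + a' *\<^sub>R i + b' *\<^sub>R j) - dd (dd f i) j x\<bar> < \<epsilon>"
    using near[of a' b'] ab' by (intro d(3)) auto
  moreover have "\<bar>dd (dd f j) i (x + a *\<^sub>R i + b *\<^sub>R j) - dd (dd f j) i x\<bar> < \<epsilon>"
    using near[of a b] ab by (intro d(4)) auto
  moreover have False if "A = B" "\<bar>A - a\<bar> < \<bar>a - b\<bar> / 2" "\<bar>B - b\<bar> < \<bar>a - b\<bar> / 2" for A B a b :: real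
    using that by (simp add: abs_if split: if_splits)
  ultimately show False unfolding \<epsilon>_def by blast
qed

section \<open>Hessians of C2 functions in arbitrary directions\<close>

context
  fixes U :: "'a::euclidean_space set" and f :: "'a \<Rightarrow> real"
  assumes C2: "C2_on U f"
begin

lemma C2_open: "open U"
  using C2 by (simp add: C2_on_def)

lemma C2_differentiable: "x \<in> U \<Longrightarrow> f differentiable (at x)"
  using C2 by (auto simp: C2_on_def differentiable_on_eq_differentiable_at)

text \<open>\<open>C2_on\<close> speaks of basis directions only; on the open set \<open>U\<close>
  the derivative in direction \<open>w\<close> is a fixed linear combination of those.\<close>

lemma C2_has_derivative_dd:
  assumes "x \<in> U"
  shows "(dd f w has_derivative (\<lambda>v. \<Sum>b\<in>Basis. (w \<bullet> b) * dd (dd f b) v x)) (at x)"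
proof (rule has_derivative_transform_within_open[OF _ C2_open assms])
  have b: "dd f b differentiable (at x)" if "b \<in> Basis" for b
    using C2 that assms by (auto simp: C2_on_def differentiable_on_eq_differentiable_at)
  show "((\<lambda>y. \<Sum>b\<in>Basis. (w \<bullet> b) * dd f b y) has_derivative
      (\<lambda>v. \<Sum>b\<in>Basis. (w \<bullet> b) * dd (dd f b) v x)) (at x)"
    by (intro has_derivative_sum has_derivative_mult_right has_derivative_dd b)
qed (use C2_differentiable in \<open>simp add: dd_basis_expand[symmetric]\<close>)

lemma C2_differentiable_dd: "x \<in> U \<Longrightarrow> dd f w differentiable (at x)"
  using C2_has_derivative_dd differentiable_def by blast

lemma C2_bilinear:
  assumes "x \<in> U"
  shows "bilinear (\<lambda>v w. dd (dd f w) v x)"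
  unfolding bilinear_def
proof safe
  show "linear (\<lambda>w. dd (dd f w) v x)" for v
  proof -
    have eq: "(\<lambda>w. dd (dd f w) v x) = (\<lambda>w. \<Sum>b\<in>Basis. (w \<bullet> b) * dd (dd f b) v x)"
      by (rule ext) (rule dd_eq[OF C2_has_derivative_dd[OF assms]])
    show ?thesis
      by (subst eq, rule linearI) (auto simp: inner_add_left sum.distrib sum_distrib_left algebra_simps)
  qed
  show "linear (\<lambda>v. dd (dd f w) v x)" for w
    by (rule linear_dd[OF C2_differentiable_dd[OF assms]])
qed

lemma C2_symmetric:
  assumes "x \<in> U"
  shows "dd (dd f w) v x = dd (dd f v) w x"
proof -
  let ?H = "\<lambda>v w. dd (dd f w) v x"
  have e: "?H v w = (\<Sum>(i,j)\<in>Basis \<times> Basis. ((v \<bullet> i) * (w \<bullet> j)) * ?H i j)" for v w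
  proof -
    have "?H v w = ?H (\<Sum>i\<in>Basis. (v \<bullet> i) *\<^sub>R i) (\<Sum>j\<in>Basis. (w \<bullet> j) *\<^sub>R j)"
      by (simp only: euclidean_representation)
    also have "\<dots> = (\<Sum>(i,j)\<in>Basis \<times> Basis. ?H ((v \<bullet> i) *\<^sub>R i) ((w \<bullet> j) *\<^sub>R j))"
      using C2_bilinear[OF assms] by (rule bilinear_sum)
    finally show ?thesis
      by (simp add: bilinear_lmul[OF C2_bilinear[OF assms]] bilinear_rmul[OF C2_bilinear[OF assms]] mult.assoc)
  qed
  have s: "?H i j = ?H j i" if "i \<in> Basis" "j \<in> Basis" for i j
    using C2 that by (intro mixed_dd_commute[OF C2_open assms C2_differentiable
      C2_differentiable_dd C2_differentiable_dd]) (auto simp: C2_on_def)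
  have "?H v w = (\<Sum>i\<in>Basis. \<Sum>j\<in>Basis. ((v \<bullet> i) * (w \<bullet> j)) * ?H i j)"
    by (subst e) (simp only: sum.cartesian_product)
  also have "\<dots> = (\<Sum>j\<in>Basis. \<Sum>i\<in>Basis. ((v \<bullet> i) * (w \<bullet> j)) * ?H i j)" by (rule sum.swap)
  also have "\<dots> = (\<Sum>j\<in>Basis. \<Sum>i\<in>Basis. ((w \<bullet> j) * (v \<bullet> i)) * ?H j i)"
    by (intro sum.cong refl) (simp add: s mult.commute)
  also have "\<dots> = ?H w v" by (subst e[where v=w and w=v]) (simp only: sum.cartesian_product)
  finally show ?thesis .
qed

end

section \<open>Curvature of radial graphs\<close>

text \<open>Moves derivatives from the point \<open>r *\<^sub>R u\<close> of the graph back to the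
  unit vector \<open>u\<close>; each differentiation costs one factor 1 / r.\<close>

lemma dd_homogeneous:
  fixes g :: "'a::real_normed_vector \<Rightarrow> real"
  assumes x: "x \<noteq> 0" and r: "r > 0" and g: "g differentiable (at x)"
    and hom: "\<And>y. y \<noteq> 0 \<Longrightarrow> g (r *\<^sub>R y) = a * g y"
  shows "dd g v (r *\<^sub>R x) = a * dd g v x / r"
proof -
  have "((\<lambda>y. y /\<^sub>R r) has_derivative (\<lambda>v. v /\<^sub>R r)) (at (r *\<^sub>R x))"
    by (auto intro!: derivative_eq_intros)
  from has_derivative_compose[OF this, of g "\<lambda>v. dd g v x"]
  have "((\<lambda>y. g (y /\<^sub>R r)) has_derivative (\<lambda>v. dd g (v /\<^sub>R r) x)) (at (r *\<^sub>R x))"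
    using r has_derivative_dd[OF g] by simp
  then have "((\<lambda>y. a * g (y /\<^sub>R r)) has_derivative (\<lambda>v. a * dd g (v /\<^sub>R r) x)) (at (r *\<^sub>R x))"
    by (rule has_derivative_mult_right)
  then have "(g has_derivative (\<lambda>v. a * dd g (v /\<^sub>R r) x)) (at (r *\<^sub>R x))"
  proof (rule has_derivative_transform_within_open[of _ _ _ _ "- {0}"])
    fix y :: 'a assume "y \<in> - {0}"
    then show "a * g (y /\<^sub>R r) = g y" using hom[of "y /\<^sub>R r"] r by simp
  qed (use x r in auto)
  then show ?thesis
    by (simp add: dd_eq linear_cmul[OF linear_dd[OF g]] divide_inverse mult.commute mult.left_commute)
qed

text \<open>Euler's identity in degree -k along the ray through \<open>x\<close>. Degree 0 gives
  \<open>L_u\<close>, degree -1 gives \<open>H_u\<close>.\<close>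

lemma dd_radial_homogeneous:
  fixes g :: "'a::real_normed_vector \<Rightarrow> real"
  assumes g: "g differentiable (at x)"
    and hom: "\<And>c. c > 0 \<Longrightarrow> g (c *\<^sub>R x) = g x / c ^ k"
  shows "dd g x x = - real k * g x"
proof -
  have "((\<lambda>t. g (x + t *\<^sub>R x)) has_real_derivative dd g x (x + 0 *\<^sub>R x)) (at 0)"
    by (rule dd_line) (simp add: g)
  then have "((\<lambda>t. g (x + t *\<^sub>R x)) has_real_derivative dd g x x) (at 0)" by simp
  moreover have "((\<lambda>t. g (x + t *\<^sub>R x)) has_real_derivative - real k * g x) (at 0)"
  proof (rule has_field_derivative_transform_within_open[of _ _ _ "{-1<..}"])
    show "((\<lambda>t. g x / (1 + t) ^ k) has_real_derivative - real k * g x) (at 0)"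
      by (auto intro!: derivative_eq_intros)
    fix t :: real assume "t \<in> {-1<..}"
    then show "g x / (1 + t) ^ k = g (x + t *\<^sub>R x)"
      using hom[of "1 + t"] by (simp add: scaleR_left_distrib)
  qed auto
  ultimately show ?thesis by (rule DERIV_unique)
qed

text \<open>To be instantiated with \<open>r = z u\<close>. Since \<open>Z\<close> below is the
  extension of \<open>z\<close> that is constant on rays, its Euclidean Hessian \<open>H\<close> at
  \<open>u\<close> agrees with the Hessian of \<open>z\<close> on the sphere when restricted to
  vectors orthogonal to \<open>u\<close>.\<close>

locale radial_graph =
  fixes z :: "'a::euclidean_space \<Rightarrow> real" and u :: 'a and r :: real
  assumes C2: "C2_on (- {0}) (\<lambda>x. z (x /\<^sub>R norm x))"
    and norm_u: "norm u = 1" and r_pos: "r > 0"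
begin

definition Z :: "'a \<Rightarrow> real" where "Z x = z (x /\<^sub>R norm x)"

definition L :: "'a \<Rightarrow> real" where "L v = dd Z v u"

definition H :: "'a \<Rightarrow> 'a \<Rightarrow> real" where "H v w = dd (dd Z w) v u"

lemma C2_Z: "C2_on (- {0}) Z"
  using C2 by (simp add: Z_def[abs_def])

lemma u_nz: "u \<noteq> 0" using norm_u by auto

lemma uu: "u \<bullet> u = 1" using norm_u by (simp add: norm_eq_1)

lemma Z_hom: "c > 0 \<Longrightarrow> Z (c *\<^sub>R x) = Z x"
  by (simp add: Z_def mult.commute[of _ c] mult.assoc[symmetric])

lemma diff_Z: "x \<noteq> 0 \<Longrightarrow> Z differentiable (at x)"
  using C2_differentiable[OF C2_Z] by simp

lemma diff_dd_Z: "x \<noteq> 0 \<Longrightarrow> dd Z w differentiable (at x)"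
  using C2_differentiable_dd[OF C2_Z] by simp

lemma dd_Z_hom: "x \<noteq> 0 \<Longrightarrow> c > 0 \<Longrightarrow> dd Z v (c *\<^sub>R x) = dd Z v x / c"
  using dd_homogeneous[of x c Z 1 v] by (simp add: Z_hom diff_Z)

lemma dd_dd_Z: "dd (dd Z w) v (r *\<^sub>R u) = H v w / r\<^sup>2"
  using dd_homogeneous[of u r "dd Z w" "1/r" v] u_nz r_pos dd_Z_hom diff_dd_Z
  by (simp add: H_def power2_eq_square)

lemma linear_L: "linear L"
  using linear_dd[OF diff_Z[OF u_nz]] by (simp add: L_def[abs_def])

lemma bilinear_H: "bilinear H"
  using C2_bilinear[OF C2_Z, of u] u_nz by (simp add: H_def[abs_def])

lemma H_sym: "H v w = H w v"
  using C2_symmetric[OF C2_Z, of u] u_nz by (simp add: H_def)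

lemma L_u: "L u = 0"
  using dd_radial_homogeneous[of Z u 0] diff_Z[OF u_nz] Z_hom by (simp add: L_def)

lemma H_u: "H u w = - L w" "H w u = - L w"
proof -
  show "H u w = - L w"
    using dd_radial_homogeneous[of "dd Z w" u 1] diff_dd_Z[OF u_nz] dd_Z_hom[OF u_nz]
    by (simp add: H_def L_def)
  then show "H w u = - L w" using H_sym by metis
qed

lemma H_tangential:
  "H (v - a *\<^sub>R u) (w - b *\<^sub>R u) = H v w + a * L w + b * L v"
  using bilinear_H linear_L
  by (simp add: bilinear_lsub bilinear_rsub bilinear_lmul bilinear_rmul linear_diff linear_cmul H_u L_u)

lemma norm_ru: "norm (r *\<^sub>R u) = r" and ru_nz: "r *\<^sub>R u \<noteq> 0"
  using norm_u r_pos by auto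

section \<open>Gradient and Hessian of the defining function in the hyperbolic metric\<close>

lemma dd_graph_fun:
  assumes "q \<noteq> 0"
  shows "dd (graph_fun z) w q = (q \<bullet> w) / norm q - dd Z w q"
proof -
  have "((\<lambda>x. norm x - Z x) has_derivative (\<lambda>v. v \<bullet> sgn q - dd Z v q)) (at q)"
    by (intro has_derivative_diff has_derivative_norm has_derivative_dd diff_Z assms)
  moreover have "graph_fun z = (\<lambda>x. norm x - Z x)" by (auto simp: graph_fun_def Z_def)
  ultimately show ?thesis
    by (simp add: dd_eq sgn_div_norm inner_commute divide_inverse mult.commute)
qed

lemma dd_graph_fun_at: "dd (graph_fun z) w (r *\<^sub>R u) = u \<bullet> w - L w / r"
  using dd_graph_fun[OF ru_nz] dd_Z_hom[OF u_nz r_pos] norm_ru r_pos by (simp add: L_def)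

lemma dd_dd_graph_fun:
  "dd (\<lambda>q. dd (graph_fun z) w q) v (r *\<^sub>R u) = (v \<bullet> w - (u \<bullet> v) * (u \<bullet> w)) / r - H v w / r\<^sup>2"
proof -
  have "((\<lambda>q. (q \<bullet> w) / norm q) has_derivative
      (\<lambda>v. - ((r *\<^sub>R u) \<bullet> w) * (inverse (norm (r *\<^sub>R u)) * (v \<bullet> sgn (r *\<^sub>R u)) * inverse (norm (r *\<^sub>R u)))
           + (v \<bullet> w) / norm (r *\<^sub>R u))) (at (r *\<^sub>R u))"
    by (intro has_derivative_divide has_derivative_norm has_derivative_inner_left has_derivative_ident ru_nz)
      (use r_pos norm_u in auto)
  then have "((\<lambda>q. (q \<bullet> w) / norm q - dd Z w q) has_derivative
      (\<lambda>v. - ((r *\<^sub>R u) \<bullet> w) * (inverse (norm (r *\<^sub>R u)) * (v \<bullet> sgn (r *\<^sub>R u)) * inverse (norm (r *\<^sub>R u)))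
           + (v \<bullet> w) / norm (r *\<^sub>R u) - dd (dd Z w) v (r *\<^sub>R u))) (at (r *\<^sub>R u))"
    by (intro has_derivative_diff has_derivative_dd diff_dd_Z ru_nz)
  then have "((\<lambda>q. dd (graph_fun z) w q) has_derivative
      (\<lambda>v. - ((r *\<^sub>R u) \<bullet> w) * (inverse (norm (r *\<^sub>R u)) * (v \<bullet> sgn (r *\<^sub>R u)) * inverse (norm (r *\<^sub>R u)))
           + (v \<bullet> w) / norm (r *\<^sub>R u) - dd (dd Z w) v (r *\<^sub>R u))) (at (r *\<^sub>R u))"
    by (rule has_derivative_transform_within_open[of _ _ _ _ "- {0}"])
      (use ru_nz in \<open>auto simp: dd_graph_fun\<close>)
  from dd_eq[OF this, of v] show ?thesis
    using r_pos norm_u by (simp add: dd_dd_Z sgn_div_norm inner_commute field_simps power2_eq_square)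
qed

definition \<sigma> :: real where "\<sigma> = (sinh r / r)\<^sup>2"

lemma sinh_pos: "sinh r > 0" using r_pos by simp

lemma \<sigma>_pos: "\<sigma> > 0" using r_pos sinh_pos by (simp add: \<sigma>_def)

lemma hyp_metric_at:
  "hyp_metric (r *\<^sub>R u) v w = (u \<bullet> v) * (u \<bullet> w) + \<sigma> * (v \<bullet> w - (u \<bullet> v) * (u \<bullet> w))"
  using r_pos norm_u by (simp add: hyp_metric_def Let_def \<sigma>_def)

text \<open>The gradient of the defining function at \<open>r *\<^sub>R u\<close>: its radial part
  is \<open>u\<close>, and the Euclidean gradient of \<open>Z\<close>, which is tangential, is
  divided by the factor by which the metric stretches tangential directions.\<close>

definition W :: 'a where "W = u - (1 / \<sigma>) *\<^sub>R (\<Sum>b\<in>Basis. (L b / r) *\<^sub>R b)"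

lemma grad_inner: "(\<Sum>b\<in>Basis. (L b / r) *\<^sub>R b) \<bullet> v = L v / r"
proof -
  have "L v = (\<Sum>b\<in>Basis. (v \<bullet> b) * L b)"
    unfolding L_def by (rule dd_basis_expand[OF diff_Z[OF u_nz]])
  then show ?thesis
    by (simp add: inner_sum_left sum_divide_distrib inner_commute[of v] mult.commute)
qed

lemma W_inner: "W \<bullet> v = u \<bullet> v - L v / r / \<sigma>"
  by (simp add: W_def inner_diff_left grad_inner)

lemma u_W: "u \<bullet> W = 1"
  using W_inner[of u] by (simp add: uu L_u inner_commute)

lemma hyp_metric_W: "hyp_metric (r *\<^sub>R u) W v = dd (graph_fun z) v (r *\<^sub>R u)"
  using \<sigma>_pos by (simp add: hyp_metric_at u_W W_inner dd_graph_fun_at)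

text \<open>\<open>hgrad\<close> is a definite description, so uniqueness is due as well. By
  Cauchy-Schwarz the metric at \<open>D\<close> is a sum of two nonnegative terms, and it vanishes
  only for \<open>D = 0\<close>.\<close>

lemma hgrad_eq: "hgrad (graph_fun z) (r *\<^sub>R u) = W"
  unfolding hgrad_def
proof (rule the_equality)
  fix W' assume W': "\<forall>V. hyp_metric (r *\<^sub>R u) W' V = dd (graph_fun z) V (r *\<^sub>R u)"
  define D where "D = W' - W"
  have "hyp_metric (r *\<^sub>R u) W' D - hyp_metric (r *\<^sub>R u) W D = 0"
    using W' hyp_metric_W by simp
  then have "hyp_metric (r *\<^sub>R u) D D = 0"
    by (simp add: hyp_metric_at D_def inner_diff_left inner_diff_right inner_commute algebra_simps)
  then have 0: "(u \<bullet> D)\<^sup>2 + \<sigma> * (D \<bullet> D - (u \<bullet> D)\<^sup>2) = 0"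
    by (simp add: hyp_metric_at power2_eq_square)
  have "(u \<bullet> D)\<^sup>2 \<le> D \<bullet> D" using Cauchy_Schwarz_ineq[of u D] by (simp add: uu)
  then have "\<sigma> * (D \<bullet> D - (u \<bullet> D)\<^sup>2) \<ge> 0" using \<sigma>_pos by simp
  then have "(u \<bullet> D)\<^sup>2 = 0" "\<sigma> * (D \<bullet> D - (u \<bullet> D)\<^sup>2) = 0"
    using 0 zero_le_power2[of "u \<bullet> D"] by linarith+
  then have "D \<bullet> D = 0" using \<sigma>_pos by auto
  then show "W' = W" by (simp add: D_def)
qed (simp add: hyp_metric_W)

text \<open>The derivative of (sinh rho / rho)^2 at rho = r.\<close>

definition \<sigma>' :: real where "\<sigma>' = 2 * (sinh r / r) * ((cosh r * r - sinh r) / r\<^sup>2)"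

lemma dd_hyp_metric:
  "dd (\<lambda>q. hyp_metric q B C) A (r *\<^sub>R u) =
     \<sigma>' * (u \<bullet> A) * (B \<bullet> C - (u \<bullet> B) * (u \<bullet> C)) +
     (1 - \<sigma>) / r * ((A \<bullet> B - (u \<bullet> A) * (u \<bullet> B)) * (u \<bullet> C) + (u \<bullet> B) * (A \<bullet> C - (u \<bullet> A) * (u \<bullet> C)))"
proof -
  define n where "n = (\<lambda>t. norm (r *\<^sub>R u + t *\<^sub>R A))"
  define \<beta> where "\<beta> = (\<lambda>B t. ((r *\<^sub>R u + t *\<^sub>R A) \<bullet> B) / n t)"
  define s where "s = (\<lambda>t. (sinh (n t) / n t)\<^sup>2)"
  have n0: "n 0 = r" using norm_ru by (simp add: n_def)
  have dn: "(n has_real_derivative u \<bullet> A) (at 0)"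
  proof -
    have "(norm has_derivative (\<lambda>h. h \<bullet> sgn (r *\<^sub>R u))) (at (r *\<^sub>R u))"
      using ru_nz by (rule has_derivative_norm)
    then have "dd norm A (r *\<^sub>R u) = u \<bullet> A"
      using r_pos norm_u by (simp add: dd_eq sgn_div_norm inner_commute)
    then show ?thesis
      unfolding n_def using dd_line[of norm "r *\<^sub>R u" 0 A] ru_nz by simp
  qed
  have \<beta>0: "\<beta> B 0 = u \<bullet> B" for B using r_pos n0 by (simp add: \<beta>_def)
  have d\<beta>: "(\<beta> B has_real_derivative (A \<bullet> B - (u \<bullet> A) * (u \<bullet> B)) / r) (at 0)" for B
  proof -
    have "((\<lambda>t. (r *\<^sub>R u + t *\<^sub>R A) \<bullet> B) has_real_derivative A \<bullet> B) (at 0)"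
      by (simp add: inner_add_left) (auto intro!: derivative_eq_intros)
    from DERIV_divide[OF this dn] show ?thesis
      unfolding \<beta>_def by (rule DERIV_cong) (use r_pos in \<open>auto simp: n0 field_simps\<close>)
  qed
  have ds: "(s has_real_derivative \<sigma>' * (u \<bullet> A)) (at 0)"
  proof -
    have "((\<lambda>t. sinh (n t)) has_real_derivative cosh (n 0) * (u \<bullet> A)) (at 0)"
      using dn by (auto intro!: derivative_eq_intros)
    from DERIV_power[OF DERIV_divide[OF this dn], of 2] show ?thesis
      unfolding s_def \<sigma>'_def
      by (rule DERIV_cong) (use r_pos in \<open>auto simp: n0 field_simps power2_eq_square\<close>)
  qed
  have s0: "s 0 = \<sigma>" by (simp add: s_def n0 \<sigma>_def)
  have "((\<lambda>t. \<beta> B t * \<beta> C t + s t * (B \<bullet> C - \<beta> B t * \<beta> C t)) has_real_derivative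
     \<sigma>' * (u \<bullet> A) * (B \<bullet> C - (u \<bullet> B) * (u \<bullet> C)) +
     (1 - \<sigma>) / r * ((A \<bullet> B - (u \<bullet> A) * (u \<bullet> B)) * (u \<bullet> C) + (u \<bullet> B) * (A \<bullet> C - (u \<bullet> A) * (u \<bullet> C)))) (at 0)"
    by (rule derivative_eq_intros d\<beta> ds refl)+ (use r_pos in \<open>simp add: \<beta>0 s0 field_simps\<close>)
  moreover have "(\<lambda>t. hyp_metric (r *\<^sub>R u + t *\<^sub>R A) B C) = (\<lambda>t. \<beta> B t * \<beta> C t + s t * (B \<bullet> C - \<beta> B t * \<beta> C t))"
    by (auto simp: hyp_metric_def Let_def \<beta>_def s_def n_def divide_inverse mult.commute)
  ultimately show ?thesis unfolding dd_def by (intro DERIV_imp_deriv) simp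
qed

text \<open>With \<open>v = ln (tanh (Z / 2))\<close>, the form \<open>l\<close> is \<open>dv\<close> and \<open>K\<close> is the Hessian of \<open>v\<close> at \<open>u\<close>. The
  map \<open>X \<mapsto> tang X\<close> identifies the tangent space of the graph with the orthogonal complement of \<open>u\<close>,
  scaled so that the metric becomes \<open>G\<close>.\<close>

definition l :: "'a \<Rightarrow> real" where "l v = L v / sinh r"
definition K :: "'a \<Rightarrow> 'a \<Rightarrow> real" where "K v w = H v w / sinh r - cosh r * l v * l w"
definition G :: "'a \<Rightarrow> 'a \<Rightarrow> real" where "G v w = v \<bullet> w + l v * l w"
definition slope :: real where "slope = sqrt (1 + (\<Sum>b\<in>Basis. (l b)\<^sup>2))"
definition B :: "'a \<Rightarrow> 'a \<Rightarrow> real" where "B v w = (cosh r * G v w - K v w) / slope"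
definition tang :: "'a \<Rightarrow> 'a" where "tang X = (sinh r / r) *\<^sub>R (X - (u \<bullet> X) *\<^sub>R u)"

lemma slope_pos: "slope > 0"
  unfolding slope_def by (simp add: add_pos_nonneg sum_nonneg)

lemma hyp_metric_W_W: "sqrt (hyp_metric (r *\<^sub>R u) W W) = slope"
proof -
  have "L W = - (\<Sum>b\<in>Basis. L b * (L b / r)) / \<sigma>"
    using linear_L
    by (simp add: W_def linear_diff linear_cmul linear_sum L_u mult.commute sum_divide_distrib)
  then have "hyp_metric (r *\<^sub>R u) W W = 1 + (\<Sum>b\<in>Basis. L b * (L b / r)) / \<sigma> / r"
    by (simp add: hyp_metric_W dd_graph_fun_at u_W)
  also have "(\<Sum>b\<in>Basis. L b * (L b / r)) / \<sigma> / r = (\<Sum>b\<in>Basis. (l b)\<^sup>2)"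
    using r_pos sinh_pos
    by (simp add: sum_divide_distrib[symmetric] l_def \<sigma>_def power2_eq_square power_divide)
  finally show ?thesis by (simp add: slope_def)
qed

lemma tang_perp: "u \<bullet> tang X = 0"
  by (simp add: tang_def inner_diff_right uu)

lemma l_tang:
  assumes "dd (graph_fun z) X (r *\<^sub>R u) = 0"
  shows "l (tang X) = u \<bullet> X"
  using assms linear_L r_pos sinh_pos
  by (simp add: l_def tang_def linear_cmul linear_diff L_u dd_graph_fun_at)

lemma inner_tang: "tang X \<bullet> tang Y = \<sigma> * (X \<bullet> Y - (u \<bullet> X) * (u \<bullet> Y))"
  by (simp add: tang_def inner_diff_left inner_diff_right uu \<sigma>_def power2_eq_square inner_commute algebra_simps)

lemma hyp_metric_tang:
  assumes "dd (graph_fun z) X (r *\<^sub>R u) = 0" "dd (graph_fun z) Y (r *\<^sub>R u) = 0"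
  shows "hyp_metric (r *\<^sub>R u) X Y = G (tang X) (tang Y)"
  using assms by (simp add: hyp_metric_at G_def l_tang inner_tang)

text \<open>Tangency ties the derivative of \<open>Z\<close> to the radial component
  (\<open>L X = r * a\<close>), so the Koszul terms reduce to multiples of \<open>a * b\<close> and
  of the tangential product \<open>c\<close>.\<close>

lemma hhess_tang:
  assumes X: "dd (graph_fun z) X (r *\<^sub>R u) = 0" and Y: "dd (graph_fun z) Y (r *\<^sub>R u) = 0"
  shows "sinh r * hhess (graph_fun z) (r *\<^sub>R u) X Y = cosh r * G (tang X) (tang Y) - K (tang X) (tang Y)"
proof -
  define a b c where abc: "a = u \<bullet> X" "b = u \<bullet> Y" "c = X \<bullet> Y - a * b"
  have XY: "X \<bullet> Y = c + a * b" by (simp add: abc)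
  have L: "L X = r * a" "L Y = r * b"
    using X Y r_pos by (simp_all add: dd_graph_fun_at abc field_simps)
  have c: "X \<bullet> Y - u \<bullet> X * (u \<bullet> Y) = c" "Y \<bullet> X - u \<bullet> Y * (u \<bullet> X) = c"
    by (simp_all add: abc inner_commute mult.commute)
  have WX: "W \<bullet> X - a = - a / \<sigma>" "W \<bullet> Y - b = - b / \<sigma>" "X \<bullet> W - a = - a / \<sigma>" "Y \<bullet> W - b = - b / \<sigma>"
    using r_pos by (simp_all add: W_inner inner_commute[of _ W] L abc)
  have Ht: "H (tang X) (tang Y) = \<sigma> * (H X Y + 2 * r * a * b)"
    unfolding tang_def
    using bilinear_H by (simp add: bilinear_lmul bilinear_rmul H_tangential L \<sigma>_def power2_eq_square abc)
  have "hhess (graph_fun z) (r *\<^sub>R u) X Y = (c / r - H X Y / r\<^sup>2) -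
     (1/2) * ((\<sigma>' * a * (- b / \<sigma>) + (1 - \<sigma>) / r * (c + b * (- a / \<sigma>)))
       + (\<sigma>' * b * (- a / \<sigma>) + (1 - \<sigma>) / r * (c + a * (- b / \<sigma>)))
       - (\<sigma>' * c + (1 - \<sigma>) / r * ((- a / \<sigma>) * b + a * (- b / \<sigma>))))"
    unfolding hhess_def Let_def hgrad_eq dd_hyp_metric dd_dd_graph_fun c u_W
    by (simp add: abc(1,2)[symmetric] WX c)
  also have "\<dots> = - H X Y / r\<^sup>2 + (\<sigma>' / \<sigma>) * a * b + (\<sigma>' / 2 + \<sigma> / r) * c"
    using r_pos \<sigma>_pos by (simp add: field_simps)
  finally have hess: "hhess (graph_fun z) (r *\<^sub>R u) X Y =
      - H X Y / r\<^sup>2 + (\<sigma>' / \<sigma>) * a * b + (\<sigma>' / 2 + \<sigma> / r) * c" .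
  \<comment> \<open>The term \<open>- 2 / r\<close> is matched by the \<open>2 * r * a * b\<close>
    that \<open>H\<close> acquires in \<open>Ht\<close> from the radial parts of \<open>X\<close>
    and \<open>Y\<close>; what remains of the change of metric is the hyperbolic cotangent.\<close>
  have q1: "\<sigma>' / \<sigma> = 2 * cosh r / sinh r - 2 / r"
    using r_pos sinh_pos by (simp add: \<sigma>_def \<sigma>'_def field_simps power2_eq_square)
  have q2: "\<sigma>' / 2 + \<sigma> / r = cosh r / sinh r * \<sigma>"
    using r_pos sinh_pos by (simp add: \<sigma>_def \<sigma>'_def field_simps power2_eq_square)
  have "cosh r * G (tang X) (tang Y) - K (tang X) (tang Y)
      = cosh r * (\<sigma> * c + 2 * a * b) - \<sigma> * (H X Y + 2 * r * a * b) / sinh r"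
    unfolding G_def K_def Ht inner_tang l_tang[OF X] l_tang[OF Y] abc(1,2)[symmetric] XY
    by (simp add: algebra_simps)
  also have "\<dots> = sinh r * hhess (graph_fun z) (r *\<^sub>R u) X Y"
    unfolding hess q1 q2
    using r_pos sinh_pos by (simp add: \<sigma>_def field_simps power2_eq_square)
  finally show ?thesis ..
qed

lemma sff_tang:
  assumes "dd (graph_fun z) X (r *\<^sub>R u) = 0" "dd (graph_fun z) Y (r *\<^sub>R u) = 0"
  shows "sinh r * sff z (r *\<^sub>R u) X Y = B (tang X) (tang Y)"
  using hhess_tang[OF assms] by (simp add: sff_def hgrad_eq hyp_metric_W_W B_def)

lemma linear_l: "linear l"
  using linear_L unfolding l_def[abs_def]
  by (intro linearI) (auto simp: linear_add linear_cmul add_divide_distrib)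

lemma bilinear_G: "bilinear G"
  unfolding G_def[abs_def] bilinear_def using linear_l
  by (auto intro!: linearI simp: linear_add linear_cmul inner_add_left inner_add_right algebra_simps)

lemma bilinear_B: "bilinear B"
proof -
  have "B (x + y) w = B x w + B y w" "B w (x + y) = B w x + B w y"
    "B (c *\<^sub>R x) w = c * B x w" "B w (c *\<^sub>R x) = c * B w x" for x y w c
    using linear_l bilinear_H bilinear_G slope_pos sinh_pos
    by (auto simp: B_def K_def linear_add linear_cmul bilinear_ladd bilinear_radd bilinear_lmul bilinear_rmul field_simps)
  then show ?thesis unfolding bilinear_def by (auto intro!: linearI)
qed

lemma G_sym: "G v w = G w v"
  by (simp add: G_def inner_commute mult.commute)

lemma B_sym: "B v w = B w v"
  by (simp add: B_def K_def G_sym[of v] H_sym[of v] mult.commute mult.left_commute)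

lemma G_pos: "v \<noteq> 0 \<Longrightarrow> G v v > 0"
  by (simp add: G_def add_pos_nonneg)

lemma tang_surj:
  assumes "u \<bullet> v = 0"
  shows "\<exists>X. dd (graph_fun z) X (r *\<^sub>R u) = 0 \<and> tang X = v"
proof (intro exI conjI)
  \<comment> \<open>The first summand undoes the scaling in \<open>tang\<close>; the radial
    coefficient is forced by \<open>l_tang\<close>.\<close>
  let ?X = "(r / sinh r) *\<^sub>R v + l v *\<^sub>R u"
  have uX: "u \<bullet> ?X = l v" using assms by (simp add: inner_add_right uu)
  show "dd (graph_fun z) ?X (r *\<^sub>R u) = 0"
    unfolding dd_graph_fun_at uX
    using linear_L r_pos by (simp add: linear_add linear_cmul L_u l_def)
  show "tang ?X = v"
    unfolding tang_def uX using r_pos sinh_pos by simp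
qed

end

section \<open>Comparison at a maximum point\<close>

lemma second_derivative_at_max:
  fixes \<phi> :: "real \<Rightarrow> real"
  assumes "d > 0" and \<phi>: "\<And>t. \<bar>t\<bar> < d \<Longrightarrow> (\<phi> has_real_derivative \<phi>' t) (at t)"
    and \<phi>': "(\<phi>' has_real_derivative D) (at 0)"
    and max: "\<And>t. \<bar>t\<bar> < d \<Longrightarrow> \<phi> t \<le> \<phi> 0"
  shows "\<phi>' 0 = 0" "D \<le> 0"
proof -
  show 0: "\<phi>' 0 = 0"
    using \<phi>[of 0] assms(1) max by (intro DERIV_local_max[of \<phi> _ 0 d]) auto
  show "D \<le> 0"
  proof (rule ccontr)
    assume "\<not> ?thesis"
    then obtain e where e: "e > 0" "\<And>h. h > 0 \<Longrightarrow> h < e \<Longrightarrow> \<phi>' 0 < \<phi>' (0 + h)"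
      using DERIV_pos_inc_right[OF \<phi>'] by auto
    define h where "h = min d e / 2"
    have h: "h > 0" "h < d" "h < e" using e assms(1) by (auto simp: h_def)
    have "\<phi> 0 < \<phi> h"
    proof (rule DERIV_pos_imp_increasing_open[OF h(1)])
      fix t assume "0 < t" "t < h"
      then show "\<exists>y. (\<phi> has_real_derivative y) (at t) \<and> y > 0"
        using \<phi>[of t] e(2)[of t] 0 h by (intro exI[of _ "\<phi>' t"]) auto
    next
      show "continuous_on {0..h} \<phi>"
        by (rule DERIV_continuous_on[where D = \<phi>'], rule has_field_derivative_at_within, rule \<phi>)
          (use h in auto)
    qed
    then show False using max[of h] h by simp
  qed
qed

lemma ln_tanh_half_deriv:
  assumes "x > 0"
  shows "((\<lambda>x. ln (tanh (x / 2))) has_real_derivative 1 / sinh x) (at x)"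
proof -
  let ?y = "x / 2"
  have p: "sinh ?y > 0" "cosh ?y > 0" "tanh ?y > 0" using assms by auto
  have "((\<lambda>x. ln (tanh (x / 2))) has_real_derivative (1 - (tanh ?y)\<^sup>2) * (1/2) / tanh ?y) (at x)"
    using p by (auto intro!: derivative_eq_intros)
  moreover have "(1 - (tanh ?y)\<^sup>2) * (1/2) / tanh ?y = 1 / sinh (2 * ?y)"
  proof -
    have "1 - (tanh ?y)\<^sup>2 = ((cosh ?y)\<^sup>2 - (sinh ?y)\<^sup>2) / (cosh ?y)\<^sup>2"
      using p by (simp add: tanh_def power_divide diff_divide_distrib)
    then have eq: "1 - (tanh ?y)\<^sup>2 = 1 / (cosh ?y)\<^sup>2"
      by (simp add: cosh_square_eq)
    show ?thesis unfolding sinh_double eq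
      using p by (simp add: tanh_def power2_eq_square)
  qed
  ultimately show ?thesis by simp
qed

context radial_graph
begin

text \<open>Derivatives may be taken along straight lines leaving the sphere, because
  \<open>Z\<close> is constant on rays. The second one turns the value \<open>K v v\<close> into the
  second derivative needed at a maximum point.\<close>

lemma ln_tanh_derivs:
  assumes zu: "z u = r" and pos: "\<And>x. x \<in> sphere 0 1 \<Longrightarrow> z x > 0"
  shows "u + t *\<^sub>R v \<noteq> 0 \<Longrightarrow> ((\<lambda>t. ln (tanh (Z (u + t *\<^sub>R v) / 2))) has_real_derivative
        dd Z v (u + t *\<^sub>R v) / sinh (Z (u + t *\<^sub>R v))) (at t)"
    and "((\<lambda>t. dd Z v (u + t *\<^sub>R v) / sinh (Z (u + t *\<^sub>R v))) has_real_derivative K v v) (at 0)"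
proof -
  have Zpos: "Z x > 0" if "x \<noteq> 0" for x
    unfolding Z_def using that by (intro pos) auto
  show "((\<lambda>t. ln (tanh (Z (u + t *\<^sub>R v) / 2))) has_real_derivative
        dd Z v (u + t *\<^sub>R v) / sinh (Z (u + t *\<^sub>R v))) (at t)" if "u + t *\<^sub>R v \<noteq> 0"
    using DERIV_chain2[OF ln_tanh_half_deriv[OF Zpos[OF that]] dd_line[OF diff_Z[OF that]]]
    by simp
  have Zu: "Z u = r" using zu norm_u by (simp add: Z_def)
  have dZ: "((\<lambda>t. Z (u + t *\<^sub>R v)) has_real_derivative L v) (at 0)"
    using dd_line[of Z u 0 v] diff_Z[OF u_nz] by (simp add: L_def)
  have ddZ: "((\<lambda>t. dd Z v (u + t *\<^sub>R v)) has_real_derivative H v v) (at 0)"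
    using dd_line[of "dd Z v" u 0 v] diff_dd_Z[OF u_nz] by (simp add: H_def)
  have "((\<lambda>t. sinh (Z (u + t *\<^sub>R v))) has_real_derivative cosh (Z (u + 0 *\<^sub>R v)) * L v) (at 0)"
    using dZ by (auto intro!: derivative_eq_intros)
  from DERIV_divide[OF ddZ this]
  show "((\<lambda>t. dd Z v (u + t *\<^sub>R v) / sinh (Z (u + t *\<^sub>R v))) has_real_derivative K v v) (at 0)"
    by (rule DERIV_cong)
      (use sinh_pos in \<open>auto simp: Zu K_def l_def L_def[symmetric] field_simps\<close>)
qed

end

text \<open>\<open>princ_curv\<close> is a choice by \<open>SOME\<close>, so a diagonalizing frame
  must first be exhibited. The frame in the conclusion is a second one: it belongs to the chosen
  vector and is carried over by \<open>tang\<close>.\<close>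

lemma princ_curv_frame:
  fixes z :: "real^('n::finite) option \<Rightarrow> real"
  assumes "radial_graph z u (z u)"
  shows "\<exists>e :: 'n \<Rightarrow> real^'n option. (\<forall>i. u \<bullet> e i = 0) \<and>
     (\<forall>i j. radial_graph.G z u (z u) (e i) (e j) = (if i = j then 1 else 0)) \<and>
     (\<forall>i j. radial_graph.B z u (z u) (e i) (e j) = (if i = j then sinh (z u) * princ_curv z u $ i else 0))"
proof -
  interpret radial_graph z u "z u" by fact
  define T where "T = {x. u \<bullet> x = 0}"
  have T: "subspace T" "dim T = CARD('n)"
    using dim_hyperplane[OF u_nz] by (auto simp: T_def subspace_hyperplane)
  have "\<exists>S\<subseteq>T. finite S \<and> card S = dim T \<and>
     (\<forall>x\<in>S. \<forall>y\<in>S. G x y = (if x = y then 1 else 0)) \<and> (\<forall>x\<in>S. \<forall>y\<in>S. x \<noteq> y \<longrightarrow> B x y = 0)"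
    by (rule simultaneous_diagonalization[OF bilinear_G bilinear_B T(1)])
      (auto intro: G_sym B_sym G_pos)
  then obtain S where S: "S \<subseteq> T" "finite S" "card S = dim T"
     "\<forall>x\<in>S. \<forall>y\<in>S. G x y = (if x = y then 1 else 0)" "\<forall>x\<in>S. \<forall>y\<in>S. x \<noteq> y \<longrightarrow> B x y = 0"
    by blast
  obtain f :: "'n \<Rightarrow> real^'n option" where f: "bij_betw f UNIV S"
    using finite_same_card_bij[of "UNIV :: 'n set" S] S(2,3) T(2) by auto
  have fS: "f i \<in> S" for i using f by (auto simp: bij_betw_def)
  have finj: "f i = f j \<longleftrightarrow> i = j" for i j using f by (auto simp: bij_betw_def inj_eq)
  have "\<forall>i. \<exists>X. dd (graph_fun z) X (z u *\<^sub>R u) = 0 \<and> tang X = f i"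
    using tang_surj fS S(1) by (auto simp: T_def)
  then obtain X where X: "\<And>i. dd (graph_fun z) (X i) (z u *\<^sub>R u) = 0" "\<And>i. tang (X i) = f i"
    by metis
  have "sinh (z u) * sff z (z u *\<^sub>R u) (X i) (X j) = B (f i) (f j)" for i j
    using sff_tang[OF X(1) X(1)] by (simp add: X(2))
  then have "sff z (z u *\<^sub>R u) (X i) (X j) = 0" if "i \<noteq> j" for i j
    using S(5) fS finj that sinh_pos by (metis less_irrefl mult_eq_0_iff)
  then have "is_princ_curv z u (\<chi> i. sff z (z u *\<^sub>R u) (X i) (X i))"
    unfolding is_princ_curv_def Let_def using X S(4) fS finj
    by (intro exI[of _ X]) (auto simp: hyp_metric_tang)
  then have "is_princ_curv z u (princ_curv z u)"
    unfolding princ_curv_def by (rule someI)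
  then obtain e :: "'n \<Rightarrow> real^'n option" where e: "\<And>i. dd (graph_fun z) (e i) (z u *\<^sub>R u) = 0"
    "\<And>i j. hyp_metric (z u *\<^sub>R u) (e i) (e j) = (if i = j then 1 else 0)"
    "\<And>i j. sff z (z u *\<^sub>R u) (e i) (e j) = (if i = j then princ_curv z u $ i else 0)"
    unfolding is_princ_curv_def Let_def by auto
  have "G (tang (e i)) (tang (e j)) = (if i = j then 1 else 0)" for i j
    using hyp_metric_tang[OF e(1) e(1)] e(2) by metis
  moreover have "B (tang (e i)) (tang (e j)) = (if i = j then sinh (z u) * princ_curv z u $ i else 0)" for i j
    using sff_tang[OF e(1) e(1), of i j] e(3)[of i j] by auto
  ultimately show ?thesis using tang_perp by (intro exI[of _ "\<lambda>i. tang (e i)"]) auto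
qed

lemma curvature_comparison_at_max:
  fixes z1 z2 :: "real^('n::finite) option \<Rightarrow> real"
  assumes C2: "C2_on (- {0}) (\<lambda>x. z1 (x /\<^sub>R norm x))" "C2_on (- {0}) (\<lambda>x. z2 (x /\<^sub>R norm x))"
    and pos: "\<And>x. x \<in> sphere 0 1 \<Longrightarrow> z1 x > 0" "\<And>x. x \<in> sphere 0 1 \<Longrightarrow> z2 x > 0"
    and u: "u \<in> sphere 0 1" and less: "z1 u < z2 u"
    and max: "\<And>x. x \<in> sphere 0 1 \<Longrightarrow>
      ln (tanh (z2 x / 2)) - ln (tanh (z1 x / 2)) \<le> ln (tanh (z2 u / 2)) - ln (tanh (z1 u / 2))"
    and gard: "garding m UNIV (($) (princ_curv z1 u))" and m: "1 \<le> m"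
  shows "sinh (z1 u) ^ m * S_m m (princ_curv z1 u) < sinh (z2 u) ^ m * S_m m (princ_curv z2 u)"
proof -
  have nu: "norm u = 1" using u by simp
  interpret g1: radial_graph z1 u "z1 u" by unfold_locales (use C2 nu pos u in auto)
  interpret g2: radial_graph z2 u "z2 u" by unfold_locales (use C2 nu pos u in auto)
  have crit: "g2.l v - g1.l v = 0 \<and> g2.K v v - g1.K v v \<le> 0" for v
  proof -
    \<comment> \<open>Keeps \<open>u + t *\<^sub>R v\<close> away from the origin for all t of
      absolute value below \<open>d\<close>.\<close>
    define d where "d = 1 / (1 + norm v)"
    have d: "d > 0" by (simp add: d_def add_pos_nonneg)
    have nz: "u + t *\<^sub>R v \<noteq> 0" if "\<bar>t\<bar> < d" for t
    proof
      assume "u + t *\<^sub>R v = 0"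
      then have "u = - (t *\<^sub>R v)" by (simp add: eq_neg_iff_add_eq_0)
      then have "1 = \<bar>t\<bar> * norm v" using nu by simp
      also have "\<dots> \<le> \<bar>t\<bar> * (1 + norm v)" by (simp add: mult_left_mono)
      also have "\<dots> < d * (1 + norm v)" using that by (intro mult_strict_right_mono) (auto simp: add_pos_nonneg)
      also have "\<dots> = 1" using norm_ge_zero[of v] unfolding d_def by (simp add: add_nonneg_eq_0_iff)
      finally show False by simp
    qed
    let ?\<phi> = "\<lambda>t. ln (tanh (g2.Z (u + t *\<^sub>R v) / 2)) - ln (tanh (g1.Z (u + t *\<^sub>R v) / 2))"
    let ?\<phi>' = "\<lambda>t. dd g2.Z v (u + t *\<^sub>R v) / sinh (g2.Z (u + t *\<^sub>R v)) - dd g1.Z v (u + t *\<^sub>R v) / sinh (g1.Z (u + t *\<^sub>R v))"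
    have "(?\<phi> has_real_derivative ?\<phi>' t) (at t)" if "\<bar>t\<bar> < d" for t
      using pos nz[OF that] by (intro DERIV_diff g1.ln_tanh_derivs(1) g2.ln_tanh_derivs(1)) auto
    moreover have "(?\<phi>' has_real_derivative g2.K v v - g1.K v v) (at 0)"
      using pos by (intro DERIV_diff g1.ln_tanh_derivs(2) g2.ln_tanh_derivs(2)) auto
    moreover have "?\<phi> t \<le> ?\<phi> 0" if "\<bar>t\<bar> < d" for t
      unfolding g1.Z_def g2.Z_def
      using max[of "(u + t *\<^sub>R v) /\<^sub>R norm (u + t *\<^sub>R v)"] nz[OF that] nu by simp
    ultimately have "?\<phi>' 0 = 0" "g2.K v v - g1.K v v \<le> 0"
      using second_derivative_at_max[OF d, of ?\<phi> ?\<phi>'] by blast+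
    then show ?thesis
      using nu by (simp add: g1.l_def g2.l_def g1.L_def g2.L_def g1.Z_def g2.Z_def)
  qed
  have l: "g2.l = g1.l" using crit by (intro ext) simp
  have G: "g2.G = g1.G" by (intro ext) (simp add: g1.G_def g2.G_def l)
  have slope: "g2.slope = g1.slope" by (simp add: g1.slope_def g2.slope_def l)
  \<comment> \<open>With equal \<open>l\<close>, hence equal \<open>G\<close> and
    \<open>slope\<close>, the two forms \<open>B\<close> differ by this multiple of \<open>G\<close>
    plus a difference of the \<open>K\<close>, which has a sign on the diagonal by
    \<open>crit\<close>.\<close>
  define \<delta> where "\<delta> = (cosh (z2 u) - cosh (z1 u)) / g1.slope"
  have "cosh (z1 u) < cosh (z2 u)" using less pos u by (intro cosh_real_strict_mono) (auto simp: less_imp_le)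
  then have \<delta>: "\<delta> > 0" using g1.slope_pos by (simp add: \<delta>_def)
  have B: "g1.B x x + \<delta> * g1.G x x \<le> g2.B x x" for x
  proof -
    have "g2.B x x - (g1.B x x + \<delta> * g1.G x x) = (g1.K x x - g2.K x x) / g1.slope"
      using g1.slope_pos by (simp add: g1.B_def g2.B_def \<delta>_def G slope field_simps)
    moreover have "\<dots> \<ge> 0" using crit[of x] g1.slope_pos by simp
    ultimately show ?thesis by simp
  qed
  obtain e1 :: "'n \<Rightarrow> real^'n option" where e1: "\<And>i. u \<bullet> e1 i = 0"
    "\<And>i j. g1.G (e1 i) (e1 j) = (if i = j then 1 else 0)"
    "\<And>i j. g1.B (e1 i) (e1 j) = (if i = j then sinh (z1 u) * princ_curv z1 u $ i else 0)"
    using princ_curv_frame[OF g1.radial_graph_axioms] by blast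
  obtain e2 :: "'n \<Rightarrow> real^'n option" where e2: "\<And>i. u \<bullet> e2 i = 0"
    "\<And>i j. g1.G (e2 i) (e2 j) = (if i = j then 1 else 0)"
    "\<And>i j. g2.B (e2 i) (e2 j) = (if i = j then sinh (z2 u) * princ_curv z2 u $ i else 0)"
    using princ_curv_frame[OF g2.radial_graph_axioms] unfolding G by blast
  have bil: "bilinear (\<lambda>x y. g1.B x y + \<delta> * g1.G x y)"
    unfolding bilinear_def
    by (intro conjI allI linearI)
      (use g1.bilinear_B g1.bilinear_G in \<open>simp_all add: bilinear_ladd bilinear_radd
        bilinear_lmul bilinear_rmul algebra_simps\<close>)
  have dimT: "dim {x. u \<bullet> x = 0} = CARD('n)" using dim_hyperplane[OF g1.u_nz] by simp
  \<comment> \<open>Adding a multiple of \<open>G\<close> keeps the frame \<open>e1\<close>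
    diagonalizing and shifts every eigenvalue by the same positive amount; this makes the comparison
    strict.\<close>
  have "\<exists>\<pi>. bij \<pi> \<and> (\<forall>i. sinh (z1 u) * princ_curv z1 u $ i + \<delta> \<le> sinh (z2 u) * princ_curv z2 u $ \<pi> i)"
    by (rule weyl_monotone[OF g1.bilinear_G bil g2.bilinear_B subspace_hyperplane[of u] dimT _ _ e1(2) e2(2) _ e2(3) B])
      (auto simp: e1 e2(1))
  then obtain \<pi> where \<pi>: "bij \<pi>"
    "\<And>i. sinh (z1 u) * princ_curv z1 u $ i + \<delta> \<le> sinh (z2 u) * princ_curv z2 u $ \<pi> i" by blast
  have "esym m UNIV (\<lambda>i. sinh (z1 u) * princ_curv z1 u $ i) < esym m UNIV (\<lambda>i. sinh (z2 u) * princ_curv z2 u $ \<pi> i)"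
  proof (rule garding_strict_mono)
    show "garding m UNIV (\<lambda>i. sinh (z1 u) * princ_curv z1 u $ i)"
      using gard g1.sinh_pos by (rule garding_scale[rotated])
    show "sinh (z1 u) * princ_curv z1 u $ i < sinh (z2 u) * princ_curv z2 u $ \<pi> i" for i
      using \<pi>(2)[of i] \<delta> by linarith
  qed (use m in auto)
  also have "\<dots> = esym m UNIV (\<lambda>i. sinh (z2 u) * princ_curv z2 u $ i)"
    using esym_image[of UNIV \<pi> m "\<lambda>i. sinh (z2 u) * princ_curv z2 u $ i"] \<pi>(1)
    by (simp add: bij_def)
  finally show ?thesis by (simp add: esym_scale S_m_esym)
qed

lemma graph_le:
  fixes z1 z2 :: "real^('n::finite) option \<Rightarrow> real"
  assumes m: "1 \<le> m" "m \<le> CARD('n)"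
    and R: "0 < R1" "R1 < R2"
    and psi_smooth: "\<exists>U. {x. R1 \<le> norm x \<and> norm x \<le> R2} \<subseteq> U \<and>
                          smooth_on U (\<lambda>x. psi (x /\<^sub>R norm x) (norm x))"
    and psi_mono: "\<And>u r. u \<in> sphere 0 1 \<Longrightarrow> r \<in> {R1..R2} \<Longrightarrow>
                     deriv (\<lambda>s. psi u s * sinh s ^ m) r \<le> 0"
    and adm: "m_admissible m z1" "m_admissible m z2"
    and bds: "\<And>u. u \<in> sphere 0 1 \<Longrightarrow> R1 \<le> z1 u \<and> z1 u \<le> R2"
             "\<And>u. u \<in> sphere 0 1 \<Longrightarrow> R1 \<le> z2 u \<and> z2 u \<le> R2"
    and eq1: "\<And>u. u \<in> sphere 0 1 \<Longrightarrow> H_m m (princ_curv z1 u) = psi u (z1 u)"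
    and eq2: "\<And>u. u \<in> sphere 0 1 \<Longrightarrow> H_m m (princ_curv z2 u) = psi u (z2 u)"
    and v: "v \<in> sphere 0 1"
  shows "z2 v \<le> z1 v"
proof (rule ccontr)
  assume "\<not> ?thesis"
  then have vless: "z1 v < z2 v" by simp
  have C2: "C2_on (- {0}) (\<lambda>x. z1 (x /\<^sub>R norm x))" "C2_on (- {0}) (\<lambda>x. z2 (x /\<^sub>R norm x))"
    and pos: "\<And>x. x \<in> sphere 0 1 \<Longrightarrow> z1 x > 0" "\<And>x. x \<in> sphere 0 1 \<Longrightarrow> z2 x > 0"
    using adm by (auto simp: m_admissible_def)
  have cont: "continuous_on (sphere 0 1) z" if C2z: "C2_on (- {0}) (\<lambda>x. z (x /\<^sub>R norm x))"
    for z :: "real^'n option \<Rightarrow> real"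
  proof -
    have "(\<lambda>x. z (x /\<^sub>R norm x)) differentiable (at x)" if "x \<in> sphere 0 1" for x
      by (rule C2_differentiable[OF C2z]) (use that in auto)
    then have "continuous_on (sphere 0 1) (\<lambda>x. z (x /\<^sub>R norm x))"
      by (intro continuous_at_imp_continuous_on ballI differentiable_imp_continuous_within)
    then show ?thesis by (rule continuous_on_eq) auto
  qed
  define g where "g = (\<lambda>x. ln (tanh (z2 x / 2)) - ln (tanh (z1 x / 2)))"
  have g_pos: "g x > 0 \<longleftrightarrow> z1 x < z2 x" if "x \<in> sphere 0 1" for x
    using pos[OF that] by (simp add: g_def)
  have "continuous_on (sphere 0 1) g"
    unfolding g_def using C2 pos
    by (intro continuous_intros cont) (fastforce simp: less_imp_neq[symmetric])+
  then obtain u where u: "u \<in> sphere 0 1" "\<And>x. x \<in> sphere 0 1 \<Longrightarrow> g x \<le> g u"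
    using continuous_attains_sup[OF compact_sphere, of 0 1 g] v by blast
  have "g v > 0" using g_pos[OF v] vless by simp
  then have less: "z1 u < z2 u" using u(2)[OF v] g_pos[OF u(1)] by simp
  have "garding m UNIV (($) (princ_curv z1 u))"
    using adm(1) u(1) m(2) by (auto simp: m_admissible_def intro: Gamma_m_garding)
  then have "sinh (z1 u) ^ m * S_m m (princ_curv z1 u) < sinh (z2 u) ^ m * S_m m (princ_curv z2 u)"
    using u m(1) less by (intro curvature_comparison_at_max[OF C2 pos]) (auto simp: g_def)
  moreover have "S_m m (princ_curv z1 u) = real (CARD('n) choose m) * psi u (z1 u)"
    "S_m m (princ_curv z2 u) = real (CARD('n) choose m) * psi u (z2 u)"
    using eq1[OF u(1)] eq2[OF u(1)] m(2) by (auto simp: H_m_def field_simps)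
  ultimately have "real (CARD('n) choose m) * (psi u (z1 u) * sinh (z1 u) ^ m)
      < real (CARD('n) choose m) * (psi u (z2 u) * sinh (z2 u) ^ m)"
    by (simp add: mult_ac)
  then have lt: "psi u (z1 u) * sinh (z1 u) ^ m < psi u (z2 u) * sinh (z2 u) ^ m"
    by (rule mult_left_less_imp_less) simp
  have "psi u (z2 u) * sinh (z2 u) ^ m \<le> psi u (z1 u) * sinh (z1 u) ^ m"
  proof (rule DERIV_nonpos_imp_nonincreasing[of "z1 u" "z2 u" "\<lambda>s. psi u s * sinh s ^ m"])
    fix s assume "z1 u \<le> s" "s \<le> z2 u"
    then have s: "s \<in> {R1..R2}" using bds[OF u(1)] by auto
    obtain U where U: "{x. R1 \<le> norm x \<and> norm x \<le> R2} \<subseteq> U"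
      "smooth_on U (\<lambda>x. psi (x /\<^sub>R norm x) (norm x))" using psi_smooth by blast
    let ?g = "\<lambda>x. psi (x /\<^sub>R norm x) (norm x)"
    have nu: "norm u = 1" using u(1) by simp
    \<comment> \<open>The empty list of directions in \<open>smooth_on\<close> stands for the
      function itself. Restricted to the ray through \<open>u\<close> this gives differentiability
      of \<open>psi u\<close>, so that the \<open>deriv\<close> in \<open>psi_mono\<close> is a
      genuine derivative.\<close>
    have "?g differentiable_on U" "open U"
      using U(2) unfolding smooth_on_def by (auto dest: spec[of _ "[]"])
    moreover have "0 + s *\<^sub>R u \<in> U" using U(1) s R nu by auto
    ultimately have "?g differentiable (at (0 + s *\<^sub>R u))"
      by (simp add: differentiable_on_eq_differentiable_at)
    from dd_line[OF this] obtain D where "((\<lambda>t. ?g (0 + t *\<^sub>R u)) has_real_derivative D) (at s)" by blast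
    then have "(psi u has_real_derivative D) (at s)"
      by (rule has_field_derivative_transform_within_open[of _ _ _ "{0<..}"])
        (use s R nu in auto)
    then have "((\<lambda>s. psi u s * sinh s ^ m) has_real_derivative
        D * sinh s ^ m + (real m * sinh s ^ (m - 1) * cosh s) * psi u s) (at s)"
      by (auto intro!: derivative_eq_intros)
    then show "\<exists>y. ((\<lambda>s. psi u s * sinh s ^ m) has_real_derivative y) (at s) \<and> y \<le> 0"
      using psi_mono[OF u(1) s] DERIV_imp_deriv by metis
  qed (use less in simp)
  then show False using lt by simp
qed

theorem theorem1p2:
  fixes m :: nat and R1 R2 :: real
    and psi :: "real^('n::finite) option \<Rightarrow> real \<Rightarrow> real"
    and z1 z2 :: "real^'n option \<Rightarrow> real"
  assumes m: "1 \<le> m" "m \<le> CARD('n)"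
    and R: "0 < R1" "R1 < R2"
    and psi_smooth: "\<exists>U. {x. R1 \<le> norm x \<and> norm x \<le> R2} \<subseteq> U \<and>
                          smooth_on U (\<lambda>x. psi (x /\<^sub>R norm x) (norm x))"
    and psi_pos: "\<And>u r. u \<in> sphere 0 1 \<Longrightarrow> r \<in> {R1..R2} \<Longrightarrow> psi u r > 0"
    and psi_mono: "\<And>u r. u \<in> sphere 0 1 \<Longrightarrow> r \<in> {R1..R2} \<Longrightarrow>
                     deriv (\<lambda>s. psi u s * sinh s ^ m) r \<le> 0"
    and adm: "m_admissible m z1" "m_admissible m z2"
    and bds: "\<And>u. u \<in> sphere 0 1 \<Longrightarrow> R1 \<le> z1 u \<and> z1 u \<le> R2"
             "\<And>u. u \<in> sphere 0 1 \<Longrightarrow> R1 \<le> z2 u \<and> z2 u \<le> R2"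
    and eq1: "\<And>u. u \<in> sphere 0 1 \<Longrightarrow> H_m m (princ_curv z1 u) = psi u (z1 u)"
    and eq2: "\<And>u. u \<in> sphere 0 1 \<Longrightarrow> H_m m (princ_curv z2 u) = psi u (z2 u)"
  shows "(\<exists>c>0. \<forall>u\<in>sphere 0 1. c * tanh (z1 u / 2) = tanh (z2 u / 2)) \<and>
         ((\<forall>u\<in>sphere 0 1. \<forall>r\<in>{R1..R2}. deriv (\<lambda>s. psi u s * sinh s ^ m) r < 0)
            \<longrightarrow> (\<forall>u\<in>sphere 0 1. z1 u = z2 u))"
proof -
  have "z1 u = z2 u" if "u \<in> sphere 0 1" for u
  proof (rule antisym)
    show "z2 u \<le> z1 u"
      by (rule graph_le[OF m R psi_smooth psi_mono adm bds eq1 eq2 that])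
    show "z1 u \<le> z2 u"
      by (rule graph_le[OF m R psi_smooth psi_mono adm(2,1) bds(2,1) eq2 eq1 that])
  qed
  then show ?thesis by (intro conjI exI[of _ 1]) auto
qed

end
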